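(* Let $q>0$. There exists a smooth diffeomorphism $\mathcal{T}:\mathcal{P}_{\mathbf{x},\mathbf{v}}\to\mathcal{P}_{\vartheta,\mathbf{a}}$, $(\mathbf{x},\mathbf{v})\mapsto(\Theta(\mathbf{x},\mathbf{v}),\mathcal{A}(\mathbf{x},\mathbf{v}))$, with inverse $(\vartheta,\mathbf{a})\mapsto(\mathbf{X}(\vartheta,\mathbf{a}),\mathbf{V}(\vartheta,\mathbf{a}))$, which (1) is canonical, i.e. $d\mathbf{x}\wedge d\mathbf{v}=d\Theta\wedge d\mathcal{A}$; (2) is compatible with conservation of energy and angular momentum: $$H(\mathbf{x},\mathbf{v})=|\mathcal{A}(\mathbf{x},\mathbf{v})|^2,\qquad \mathbf{x}\times\mathbf{v}=\Theta(\mathbf{x},\mathbf{v})\times\mathcal{A}(\mathbf{x},\mathbf{v});$$ (3) linearizes the flow of the Kepler system in the sense that $(\mathbf{x}(t),\mathbf{v}(t))$ solves $$\dot{\mathbf{x}}=\mathbf{v},\qquad \dot{\mathbf{v}}=\frac q2\frac{\mathbf{x}}{|\mathbf{x}|^3}$$ if and only if $$\Theta(\mathbf{x}(t),\mathbf{v}(t))=\Theta(\mathbf{x}(0),\mathbf{v}(0))+t\mathcal{A}(\mathbf{x}(0),\mathbf{v}(0)),\qquad \mathcal{A}(\mathbf{x}(t),\mathbf{v}(t))=\mathcal{A}(\mathbf{x}(0),\mathbf{v}(0));$$ (4) satisfies the asymptotic action property $$|\mathbf{X}(\vartheta+t\mathbf{a},\mathbf{a})-t\mathbf{a}|=o(t),\qquad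 |\mathbf{V}(\vartheta+t\mathbf{a},\mathbf{a})-\mathbf{a}|=o(1)\qquad\text{as }t\to+\infty.$$
   Context: $\mathcal{P}_{\mathbf{x},\mathbf{v}}=\{(\mathbf{x},\mathbf{v})\in\mathbb{R}^3\times\mathbb{R}^3:|\mathbf{x}|>0\}$, $\mathcal{P}_{\vartheta,\mathbf{a}}=\{(\vartheta,\mathbf{a})\in\mathbb{R}^3\times\mathbb{R}^3:|\mathbf{a}|>0\}$, and $H(\mathbf{x},\mathbf{v})=|\mathbf{v}|^2+\frac{q}{|\mathbf{x}|}$. The notation $d\mathbf{x}\wedge d\mathbf{v}$ means $\sum_j d\mathbf{x}^j\wedge d\mathbf{v}^j$, and similarly for $d\Theta\wedge d\mathcal{A}$. *)

theory Defs
  imports "HOL-Analysis.Analysis" "HOL-Library.Landau_Symbols"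
begin

type_synonym phase = "(real^3) \<times> (real^3)"

definition phase_xv :: "phase set"
  where "phase_xv = {(x, v). norm x > 0}"

definition phase_theta_a :: "phase set"
  where "phase_theta_a = {(\<theta>, a). norm a > 0}"

definition kepler_H :: "real \<Rightarrow> phase \<Rightarrow> real"
  where "kepler_H q = (\<lambda>(x, v). (norm v)\<^sup>2 + q / norm x)"

(* For an open set S in a finite-dimensional space, this is the class C^k: the Suc step asks
   that every directional derivative be of class C^n, and these determine the derivative. *)
primrec Ck_on :: "nat \<Rightarrow> 'a::real_normed_vector set \<Rightarrow> ('a \<Rightarrow> 'b::real_normed_vector) \<Rightarrow> bool"
  where
    "Ck_on 0 S f \<longleftrightarrow> continuous_on S f"
  | "Ck_on (Suc n) S f \<longleftrightarrow>
       (\<forall>x\<in>S. f differentiable (at x)) \<and>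
       (\<forall>v. Ck_on n S (\<lambda>x. frechet_derivative f (at x) v))"

definition smooth_on :: "'a::real_normed_vector set \<Rightarrow> ('a \<Rightarrow> 'b::real_normed_vector) \<Rightarrow> bool"
  where "smooth_on S f \<longleftrightarrow> (\<forall>k. Ck_on k S f)"

definition smooth_diffeomorphism ::
    "'a::real_normed_vector set \<Rightarrow> 'b::real_normed_vector set \<Rightarrow> ('a \<Rightarrow> 'b) \<Rightarrow> ('b \<Rightarrow> 'a) \<Rightarrow> bool"
  where "smooth_diffeomorphism S T f g \<longleftrightarrow>
    homeomorphism S T f g \<and> smooth_on S f \<and> smooth_on T g"

definition wedge :: "('a \<Rightarrow> real) \<Rightarrow> ('a \<Rightarrow> real) \<Rightarrow> 'a \<Rightarrow> 'a \<Rightarrow> real"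
  where "wedge \<alpha> \<beta> = (\<lambda>\<xi> \<eta>. \<alpha> \<xi> * \<beta> \<eta> - \<alpha> \<eta> * \<beta> \<xi>)"

(* The value at p of the two-form dF /\ dG = sum_j dF^j /\ dG^j, as a bilinear form on
   tangent vectors. With F = fst and G = snd this is dx /\ dv. *)
definition wedge_d ::
    "('a::real_normed_vector \<Rightarrow> real^'n) \<Rightarrow> ('a \<Rightarrow> real^'n) \<Rightarrow> 'a \<Rightarrow> 'a \<Rightarrow> 'a \<Rightarrow> real"
  where "wedge_d F G p = (\<lambda>\<xi> \<eta>. \<Sum>j\<in>UNIV.
    wedge (frechet_derivative (\<lambda>z. F z $ j) (at p)) (frechet_derivative (\<lambda>z. G z $ j) (at p)) \<xi> \<eta>)"

definition kepler_solution_on :: "real \<Rightarrow> real set \<Rightarrow> (real \<Rightarrow> real^3) \<Rightarrow> (real \<Rightarrow> real^3) \<Rightarrow> bool"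
  where "kepler_solution_on q I x v \<longleftrightarrow>
    (\<forall>t\<in>I. (x has_vector_derivative v t) (at t within I) \<and>
           (v has_vector_derivative (q / 2) *\<^sub>R (x t /\<^sub>R norm (x t) ^ 3)) (at t within I))"

end

theory Submission
  imports Defs
begin

text \<open>
  The force is repulsive, so every orbit escapes to infinity with an asymptotic velocity \<open>a\<close>, and
  \<open>|a|\<^sup>2 = H\<close>. Properties (3) and (4) force the action to be this velocity. For the Kepler problem the eikonal
  equation \<open>|\<nabla>S|\<^sup>2 + q / |x| = |a|\<^sup>2\<close> has an explicit solution in parabolic coordinates,
  \<open>S = x \<bullet> a + g(|a|\<^sup>2 |x| + |a| (x \<bullet> a)) / |a|\<close>, and \<open>v = \<partial>S/\<partial>x\<close>, \<open>\<theta> = \<partial>S/\<partial>a\<close> define the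
  transformation. As a function of \<open>x\<close> and \<open>a\<close>, however, \<open>S\<close> is two-valued, because the orbits with
  asymptotic velocity \<open>a\<close> have an envelope and pass twice through each point on one side of it. This
  is cured by eliminating \<open>a\<close>: with
  \<open>\<alpha> = \<surd>H\<close>, \<open>k = q / (2\<alpha>)\<close>, \<open>\<rho> = x \<bullet> v + \<alpha>|x|\<close> and \<open>D = \<rho> - k\<close>, one finds
  \<open>A = (\<rho> v + (q/2) x/|x|) / D\<close> and
  \<open>\<Theta> = (D / \<rho>) x + (k / \<alpha>\<^sup>2) (ln (D / k) - \<alpha>|x| / \<rho>) A\<close>.
  These expressions are single valued and smooth on the whole phase space since \<open>\<rho> > k > 0\<close>
  (lemma \<open>excess_pos\<close>).

  Each property is then a computation with these formulas. Since \<open>\<Theta>\<close> equals \<open>(D / \<rho>) x\<close> up to a multiple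
  of \<open>A\<close>, and \<open>A\<close> equals \<open>(\<rho> / D) v\<close> up to a multiple of \<open>x\<close>, the cross products \<open>\<Theta> \<times> A\<close> and
  \<open>x \<times> v\<close> agree; the same cancellation leaves \<open>dx \<and> dv\<close> plus products of
  scalar one-forms in \<open>d\<Theta> \<and> dA\<close>, and the latter add up to zero (\<open>angle_action_canonical\<close>). Along the
  Kepler vector field \<open>A\<close> has derivative \<open>0\<close> and \<open>\<Theta>\<close> has derivative \<open>A\<close> (\<open>along_flow\<close>); because the
  transformation is a diffeomorphism, this identity of vector fields gives both directions of (3).

  For the inverse, \<open>a\<close> gives \<open>\<alpha>\<close> and \<open>k\<close>, and the pair \<open>(\<theta>, a)\<close> gives the squared angular momentum
  \<open>L\<close>. The one remaining unknown \<open>w = ln (D / k)\<close> satisfies a form of Kepler's equation,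
  \<open>w + (e\<^sup>w - (1 + L / k\<^sup>2) e\<^sup>-\<^sup>w) / 2 = (\<theta> \<bullet> a) / k\<close>, whose left side is strictly increasing and onto.
  Its solution depends smoothly on the data (\<open>smooth_on_kepler_root\<close>), and \<open>x\<close> and \<open>v\<close> are explicit in
  \<open>w\<close>. Replacing \<open>\<theta>\<close> by \<open>\<theta> + t a\<close> keeps \<open>L\<close> and adds \<open>t \<alpha>\<^sup>2 / k\<close> to the right side, so
  \<open>w \<rightarrow> \<infinity>\<close> while \<open>w = o(t)\<close>, which yields (4).
\<close>

section \<open>Calculus of smooth maps\<close>

lemma Ck_on_SucI:
  assumes "\<And>x. x \<in> S \<Longrightarrow> (f has_derivative f' x) (at x)"
    and "\<And>v. Ck_on n S (\<lambda>x. frechet_derivative f (at x) v)"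
  shows "Ck_on (Suc n) S f"
  using assms by (auto simp: differentiable_def Ck_on.simps(2))

lemma Ck_on_cong:
  assumes "open S" "\<And>x. x \<in> S \<Longrightarrow> f x = g x" "Ck_on n S f"
  shows "Ck_on n S g"
  using assms(2,3)
proof (induction n arbitrary: f g)
  case 0
  then show ?case by (simp cong: continuous_on_cong)
next
  case (Suc n)
  have der: "(g has_derivative frechet_derivative f (at x)) (at x)" if "x \<in> S" for x
  proof (rule has_derivative_transform_within_open[OF _ assms(1) that])
    show "(f has_derivative frechet_derivative f (at x)) (at x)"
      using Suc.prems that by (simp add: frechet_derivative_works Ck_on.simps(2))
  qed (rule Suc.prems)
  then have "frechet_derivative f (at x) v = frechet_derivative g (at x) v" if "x \<in> S" for x v
    using that frechet_derivative_at by metis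
  then have "Ck_on n S (\<lambda>x. frechet_derivative g (at x) v)" for v
    using Suc.IH[of "\<lambda>x. frechet_derivative f (at x) v"] Suc.prems(2)
    by (simp add: Ck_on.simps(2))
  with der show ?case by (rule Ck_on_SucI)
qed

declare Ck_on.simps(2) [simp del]

lemma Ck_on_Suc_derivative: "Ck_on (Suc n) S f \<Longrightarrow> Ck_on n S (\<lambda>x. frechet_derivative f (at x) v)"
  by (simp add: Ck_on.simps(2))

text \<open>On an open set the derivative may be given by any formula valid there; off the set the values
  of \<open>frechet_derivative\<close> are irrelevant by \<open>Ck_on_cong\<close>.\<close>

lemma Ck_on_Suc_derivativeI:
  assumes "open S" "\<And>x. x \<in> S \<Longrightarrow> (f has_derivative f' x) (at x)"
    and "\<And>v. Ck_on n S (\<lambda>x. f' x v)"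
  shows "Ck_on (Suc n) S f"
proof (rule Ck_on_SucI)
  show "Ck_on n S (\<lambda>x. frechet_derivative f (at x) v)" for v
    using assms by (intro Ck_on_cong[OF assms(1) _ assms(3)[of v]]) (metis frechet_derivative_at)
qed (fact assms(2))

lemma Ck_on_Suc_has_derivative:
  "Ck_on (Suc n) S f \<Longrightarrow> x \<in> S \<Longrightarrow> (f has_derivative frechet_derivative f (at x)) (at x)"
  by (simp add: frechet_derivative_works Ck_on.simps(2))

lemma Ck_on_SucD: "Ck_on (Suc n) S f \<Longrightarrow> Ck_on n S f"
proof (induction n arbitrary: f)
  case 0
  then show ?case
    by (auto simp: Ck_on.simps(2)
        intro!: continuous_at_imp_continuous_on differentiable_imp_continuous_within)
next
  case (Suc n)
  then show ?case by (simp add: Ck_on.simps(2)[of "Suc n"] Ck_on.simps(2)[of n])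
qed

text \<open>A function whose derivative is a smooth expression in the function itself gains one order of
  differentiability at each step. This covers \<open>exp\<close>, \<open>inverse\<close> and \<open>sqrt\<close>, and also functions
  that are only defined implicitly.\<close>

lemma smooth_on_bootstrap:
  assumes "open S" "\<And>x. x \<in> S \<Longrightarrow> (f has_derivative f' x) (at x)"
    and "\<And>n v. Ck_on n S f \<Longrightarrow> Ck_on n S (\<lambda>x. f' x v)"
  shows "smooth_on S f"
proof -
  have "Ck_on n S f" for n
  proof (induction n)
    case 0
    show ?case using assms(2)
      by (auto intro!: continuous_at_imp_continuous_on has_derivative_continuous)
  next
    case (Suc n)
    then show ?case using assms by (blast intro: Ck_on_Suc_derivativeI)
  qed
  then show ?thesis by (simp add: smooth_on_def)
qed

lemma smooth_on_has_derivative: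
  "smooth_on S f \<Longrightarrow> x \<in> S \<Longrightarrow> (f has_derivative frechet_derivative f (at x)) (at x)"
  unfolding smooth_on_def using Ck_on_Suc_has_derivative by blast

lemma smooth_on_continuous_on: "smooth_on S f \<Longrightarrow> continuous_on S f"
  unfolding smooth_on_def by (metis Ck_on.simps(1))

lemma Ck_on_const: "open S \<Longrightarrow> Ck_on n S (\<lambda>x. c)"
proof (induction n arbitrary: c)
  case (Suc n)
  then show ?case by (intro Ck_on_Suc_derivativeI[where f' = "\<lambda>x v. 0"]) auto
qed simp

lemma Ck_on_bounded_linear: "open S \<Longrightarrow> bounded_linear f \<Longrightarrow> Ck_on n S f"
  using smooth_on_bootstrap[of S f "\<lambda>x. f"] Ck_on_const
  unfolding smooth_on_def by (blast intro: bounded_linear_imp_has_derivative)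

lemma Ck_on_add:
  "open S \<Longrightarrow> Ck_on n S f \<Longrightarrow> Ck_on n S g \<Longrightarrow> Ck_on n S (\<lambda>x. f x + g x)"
proof (induction n arbitrary: f g)
  case 0
  then show ?case by (simp add: continuous_on_add)
next
  case (Suc n)
  show ?case
    by (rule Ck_on_Suc_derivativeI[OF Suc.prems(1) has_derivative_add
          [OF Suc.prems(2,3)[THEN Ck_on_Suc_has_derivative]]])
       (use Suc in \<open>auto intro: Ck_on_Suc_derivative\<close>)
qed

lemma Ck_on_sum:
  "open S \<Longrightarrow> (\<And>i. i \<in> I \<Longrightarrow> Ck_on n S (f i)) \<Longrightarrow> Ck_on n S (\<lambda>x. \<Sum>i\<in>I. f i x)"
  by (induction I rule: infinite_finite_induct) (auto intro: Ck_on_const Ck_on_add)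

lemma (in bounded_bilinear) Ck_on_prod:
  "open S \<Longrightarrow> Ck_on n S f \<Longrightarrow> Ck_on n S g \<Longrightarrow> Ck_on n S (\<lambda>x. prod (f x) (g x))"
proof (induction n arbitrary: f g)
  case 0
  then show ?case by (simp add: continuous_on)
next
  case (Suc n)
  show ?case
    by (rule Ck_on_Suc_derivativeI[OF Suc.prems(1) FDERIV
          [OF Suc.prems(2,3)[THEN Ck_on_Suc_has_derivative]]])
       (use Suc in \<open>auto intro!: Ck_on_add intro: Ck_on_SucD Ck_on_Suc_derivative\<close>)
qed

lemma Ck_on_compose:
  fixes g :: "'a::real_normed_vector \<Rightarrow> 'b::euclidean_space"
  assumes "open S" "open T"
  shows "g ` S \<subseteq> T \<Longrightarrow> Ck_on n T f \<Longrightarrow> Ck_on n S g \<Longrightarrow> Ck_on n S (\<lambda>x. f (g x))"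
proof (induction n arbitrary: f)
  case 0
  then show ?case by (auto intro: continuous_on_compose2)
next
  case (Suc n)
  let ?f' = "\<lambda>y. frechet_derivative f (at y)" and ?g' = "\<lambda>x. frechet_derivative g (at x)"
  have derf: "(f has_derivative ?f' (g x)) (at (g x))" if "x \<in> S" for x
    using Suc.prems that by (blast intro: Ck_on_Suc_has_derivative)
  have derg: "(g has_derivative ?g' x) (at x)" if "x \<in> S" for x
    using Suc.prems that by (blast intro: Ck_on_Suc_has_derivative)
  \<comment> \<open>Expanding the chain rule in a basis turns the directional derivative of \<open>f \<circ> g\<close> into a sum of
      products to which the induction hypothesis applies.\<close>
  have expand: "?f' (g x) (?g' x v) = (\<Sum>b\<in>Basis. (?g' x v \<bullet> b) *\<^sub>R ?f' (g x) b)"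
    if "x \<in> S" for x v
  proof -
    interpret linear "?f' (g x)" using derf[OF that] by (rule has_derivative_linear)
    have "?f' (g x) (\<Sum>b\<in>Basis. (?g' x v \<bullet> b) *\<^sub>R b) = (\<Sum>b\<in>Basis. (?g' x v \<bullet> b) *\<^sub>R ?f' (g x) b)"
      by (simp add: sum scale)
    then show ?thesis by (simp add: euclidean_representation)
  qed
  show ?case
  proof (rule Ck_on_Suc_derivativeI[OF assms(1)])
    show "((\<lambda>x. f (g x)) has_derivative (\<lambda>v. \<Sum>b\<in>Basis. (?g' x v \<bullet> b) *\<^sub>R ?f' (g x) b)) (at x)"
      if "x \<in> S" for x
      using has_derivative_compose[OF derg[OF that] derf[OF that]] expand[OF that] by simp
    show "Ck_on n S (\<lambda>x. \<Sum>b\<in>Basis. (?g' x v \<bullet> b) *\<^sub>R ?f' (g x) b)" for v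
    proof (intro Ck_on_sum assms(1) bounded_bilinear.Ck_on_prod[OF bounded_bilinear_scaleR])
      fix b :: 'b
      show "Ck_on n S (\<lambda>x. ?g' x v \<bullet> b)"
        using Suc.prems
        by (intro bounded_bilinear.Ck_on_prod[OF bounded_bilinear_inner] assms(1) Ck_on_const
            Ck_on_Suc_derivative)
      show "Ck_on n S (\<lambda>x. ?f' (g x) b)"
        using Suc.prems by (intro Suc.IH) (auto intro: Ck_on_SucD Ck_on_Suc_derivative)
    qed
  qed
qed

lemma smooth_on_const: "open S \<Longrightarrow> smooth_on S (\<lambda>x. c)"
  by (simp add: smooth_on_def Ck_on_const)

lemma smooth_on_bounded_linear: "open S \<Longrightarrow> bounded_linear f \<Longrightarrow> smooth_on S f"
  by (simp add: smooth_on_def Ck_on_bounded_linear)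

lemma smooth_on_add:
  "open S \<Longrightarrow> smooth_on S f \<Longrightarrow> smooth_on S g \<Longrightarrow> smooth_on S (\<lambda>x. f x + g x)"
  by (simp add: smooth_on_def Ck_on_add)

lemma (in bounded_bilinear) smooth_on_prod:
  "open S \<Longrightarrow> smooth_on S f \<Longrightarrow> smooth_on S g \<Longrightarrow> smooth_on S (\<lambda>x. prod (f x) (g x))"
  by (simp add: smooth_on_def Ck_on_prod)

lemmas smooth_on_mult = bounded_bilinear.smooth_on_prod[OF bounded_bilinear_mult]
lemmas smooth_on_scaleR = bounded_bilinear.smooth_on_prod[OF bounded_bilinear_scaleR]
lemmas smooth_on_inner = bounded_bilinear.smooth_on_prod[OF bounded_bilinear_inner]

lemma smooth_on_compose:
  fixes g :: "'a::real_normed_vector \<Rightarrow> 'b::euclidean_space"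
  assumes "open S" "open T" "smooth_on T f" "smooth_on S g" "\<And>x. x \<in> S \<Longrightarrow> g x \<in> T"
  shows "smooth_on S (\<lambda>x. f (g x))"
  using assms Ck_on_compose[of S T g] unfolding smooth_on_def by (metis image_subsetI)

text \<open>Here the codomain of \<open>g\<close> may be any normed space, since no basis is needed to differentiate.\<close>

lemma smooth_on_bounded_linear_compose:
  assumes "open S" "bounded_linear f" "smooth_on S g"
  shows "smooth_on S (\<lambda>x. f (g x))"
proof -
  have "Ck_on n S g \<Longrightarrow> Ck_on n S (\<lambda>x. f (g x))" for n
  proof (induction n arbitrary: g)
    case 0
    then show ?case by (simp add: bounded_linear.continuous_on[OF assms(2)])
  next
    case (Suc n)
    show ?case
      by (rule Ck_on_Suc_derivativeI[OF assms(1) bounded_linear.has_derivative[OF assms(2)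
            Ck_on_Suc_has_derivative[OF Suc.prems]]])
         (use Suc in \<open>auto intro: Ck_on_Suc_derivative\<close>)
  qed
  with assms(3) show ?thesis by (simp add: smooth_on_def)
qed

lemma smooth_on_minus: "open S \<Longrightarrow> smooth_on S f \<Longrightarrow> smooth_on S (\<lambda>x. - f x)"
  by (rule smooth_on_bounded_linear_compose) (auto intro: bounded_linear_minus bounded_linear_ident)

lemma smooth_on_diff:
  "open S \<Longrightarrow> smooth_on S f \<Longrightarrow> smooth_on S g \<Longrightarrow> smooth_on S (\<lambda>x. f x - g x)"
  using smooth_on_add[of S f "\<lambda>x. - g x"] smooth_on_minus[of S g] by simp

lemma smooth_on_fst: "open S \<Longrightarrow> smooth_on S fst"
  and smooth_on_snd: "open S \<Longrightarrow> smooth_on S snd"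
  by (rule smooth_on_bounded_linear; simp add: bounded_linear_fst bounded_linear_snd)+

lemma smooth_on_Pair:
  assumes "open S" "smooth_on S f" "smooth_on S g"
  shows "smooth_on S (\<lambda>x. (f x, g x))"
proof -
  have "smooth_on S (\<lambda>x. (f x, 0) + (0, g x))"
    using assms bounded_linear_Pair[OF bounded_linear_ident bounded_linear_zero]
      bounded_linear_Pair[OF bounded_linear_zero bounded_linear_ident]
    by (intro smooth_on_add smooth_on_bounded_linear_compose[of S "\<lambda>y. (y, 0)" f]
        smooth_on_bounded_linear_compose[of S "\<lambda>y. (0, y)" g]) auto
  then show ?thesis by simp
qed

lemma smooth_on_power2:
  fixes f :: "'a::real_normed_vector \<Rightarrow> real"
  shows "open S \<Longrightarrow> smooth_on S f \<Longrightarrow> smooth_on S (\<lambda>x. (f x)\<^sup>2)"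
  by (simp add: power2_eq_square smooth_on_mult)

lemma smooth_on_real_bootstrap:
  fixes f :: "real \<Rightarrow> real"
  assumes "open S" "\<And>x. x \<in> S \<Longrightarrow> (f has_real_derivative f' x) (at x)"
    and "\<And>n. Ck_on n S f \<Longrightarrow> Ck_on n S f'"
  shows "smooth_on S f"
  using assms
  by (intro smooth_on_bootstrap[where f' = "\<lambda>x v. f' x * v"]
      bounded_bilinear.Ck_on_prod[OF bounded_bilinear_mult] Ck_on_const)
     (auto simp: has_field_derivative_def)

lemma smooth_on_exp:
  fixes f :: "'a::real_normed_vector \<Rightarrow> real"
  assumes "open S" "smooth_on S f"
  shows "smooth_on S (\<lambda>x. exp (f x))"
proof -
  have "smooth_on UNIV (exp :: real \<Rightarrow> real)"
    by (rule smooth_on_real_bootstrap[where f' = exp]) (auto intro: DERIV_exp)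
  with assms show ?thesis by (intro smooth_on_compose[of S UNIV exp f]) auto
qed

lemma smooth_on_inverse_real: "smooth_on {0<..} (inverse :: real \<Rightarrow> real)"
proof (rule smooth_on_real_bootstrap)
  show "(inverse has_real_derivative - 1 * (inverse x * inverse x)) (at x)"
    if "x \<in> {0<..}" for x :: real
    using that DERIV_inverse[of x] by (simp add: power2_eq_square)
  show "Ck_on n {0<..} (\<lambda>x::real. - 1 * (inverse x * inverse x))"
    if "Ck_on n {0<..} (inverse :: real \<Rightarrow> real)" for n
    using that by (intro bounded_bilinear.Ck_on_prod[OF bounded_bilinear_mult] Ck_on_const) simp_all
qed simp

lemma smooth_on_divide:
  fixes f g :: "'a::real_normed_vector \<Rightarrow> real"
  assumes "open S" "smooth_on S f" "smooth_on S g" "\<And>x. x \<in> S \<Longrightarrow> g x > 0"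
  shows "smooth_on S (\<lambda>x. f x / g x)"
proof -
  have "smooth_on S (\<lambda>x. inverse (g x))"
    using assms smooth_on_inverse_real by (intro smooth_on_compose[of S "{0<..}" inverse g]) auto
  then show ?thesis using assms smooth_on_mult[of S f "\<lambda>x. inverse (g x)"]
    by (simp add: divide_inverse)
qed

lemma smooth_on_ln:
  fixes f :: "'a::real_normed_vector \<Rightarrow> real"
  assumes "open S" "smooth_on S f" "\<And>x. x \<in> S \<Longrightarrow> f x > 0"
  shows "smooth_on S (\<lambda>x. ln (f x))"
proof -
  have "smooth_on {0<..} (ln :: real \<Rightarrow> real)"
    by (rule smooth_on_real_bootstrap[where f' = inverse])
       (use smooth_on_inverse_real in \<open>auto simp: smooth_on_def intro: DERIV_ln\<close>)
  with assms show ?thesis by (intro smooth_on_compose[of S "{0<..}" ln f]) auto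
qed

lemma smooth_on_sqrt:
  fixes f :: "'a::real_normed_vector \<Rightarrow> real"
  assumes "open S" "smooth_on S f" "\<And>x. x \<in> S \<Longrightarrow> f x > 0"
  shows "smooth_on S (\<lambda>x. sqrt (f x))"
proof -
  have "smooth_on {0<..} sqrt"
  proof (rule smooth_on_real_bootstrap[where f' = "\<lambda>x. inverse (sqrt x) * (1 / 2)"])
    show "(sqrt has_real_derivative inverse (sqrt x) * (1 / 2)) (at x)" if "x \<in> {0<..}" for x
      using that DERIV_real_sqrt[of x] by simp
    have "Ck_on n {0<..} (inverse :: real \<Rightarrow> real)" for n
      using smooth_on_inverse_real by (simp add: smooth_on_def)
    then show "Ck_on n {0<..} (\<lambda>x. inverse (sqrt x) * (1 / 2))" if "Ck_on n {0<..} sqrt" for n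
      using that by (intro bounded_bilinear.Ck_on_prod[OF bounded_bilinear_mult] Ck_on_const
          Ck_on_compose[of "{0<..}" "{0<..}" sqrt _ inverse]) auto
  qed simp
  with assms show ?thesis by (intro smooth_on_compose[of S "{0<..}" sqrt f]) auto
qed

lemma smooth_on_norm:
  fixes f :: "'a::real_normed_vector \<Rightarrow> 'b::euclidean_space"
  assumes "open S" "smooth_on S f" "\<And>x. x \<in> S \<Longrightarrow> f x \<noteq> 0"
  shows "smooth_on S (\<lambda>x. norm (f x))"
  unfolding norm_eq_sqrt_inner using assms by (intro smooth_on_sqrt smooth_on_inner) auto

lemmas smooth_on_intros = smooth_on_const smooth_on_fst smooth_on_snd smooth_on_add smooth_on_minus
  smooth_on_diff smooth_on_mult smooth_on_scaleR smooth_on_inner smooth_on_Pair smooth_on_power2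
  smooth_on_exp smooth_on_divide smooth_on_ln smooth_on_sqrt smooth_on_norm

section \<open>Kepler's equation\<close>

text \<open>With \<open>w = u + (ln C) / 2\<close> this is \<open>u + \<surd>C sinh u\<close> up to a constant, the left side of
  Kepler's equation for a repulsive orbit of eccentricity \<open>\<surd>C\<close>.\<close>

definition kepler_lhs :: "real \<Rightarrow> real \<Rightarrow> real"
  where "kepler_lhs C w = w + (exp w - C * exp (- w)) / 2"

definition kepler_root :: "real \<Rightarrow> real \<Rightarrow> real"
  where "kepler_root C m = (THE w. kepler_lhs C w = m)"

lemma kepler_lhs_strict_mono:
  assumes "C > 0" "w < w'"
  shows "kepler_lhs C w < kepler_lhs C w'"
proof -
  have "exp w < exp w'" "C * exp (- w') < C * exp (- w)" using assms by auto
  with assms(2) show ?thesis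
    unfolding kepler_lhs_def by (intro add_strict_mono divide_strict_right_mono diff_strict_mono) auto
qed

lemma kepler_lhs_surj:
  assumes "C > 0"
  shows "\<exists>w. kepler_lhs C w = m"
proof -
  \<comment> \<open>At these points the exponentials that could spoil the estimate are at most \<open>1\<close>.\<close>
  define a b where "a = min 0 (m - 1)" and "b = max 0 (m + C)"
  have "exp a \<le> 1" "0 \<le> C * exp (- a)" using assms by (auto simp: a_def)
  then have "kepler_lhs C a \<le> a + 1 / 2"
    unfolding kepler_lhs_def by (intro add_left_mono divide_right_mono) linarith+
  then have "kepler_lhs C a \<le> m" unfolding a_def by linarith
  moreover have "0 \<le> exp b" "C * exp (- b) \<le> C" using assms by (auto simp: b_def)
  then have "b + (- C) / 2 \<le> kepler_lhs C b"
    unfolding kepler_lhs_def by (intro add_left_mono divide_right_mono) linarith+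
  then have "m \<le> kepler_lhs C b" using assms unfolding b_def by linarith
  moreover have "a \<le> b" by (auto simp: a_def b_def)
  moreover have "continuous_on {a..b} (kepler_lhs C)"
    unfolding kepler_lhs_def by (intro continuous_intros) auto
  ultimately show ?thesis by (metis IVT')
qed

lemma kepler_root_eqI: "C > 0 \<Longrightarrow> kepler_lhs C w = m \<Longrightarrow> kepler_root C m = w"
  unfolding kepler_root_def
  by (rule the_equality) (simp, metis kepler_lhs_strict_mono linorder_neqE_linordered_idom order_less_irrefl)

lemma kepler_lhs_root: "C > 0 \<Longrightarrow> kepler_lhs C (kepler_root C m) = m"
  by (metis kepler_lhs_surj kepler_root_eqI)

text \<open>The map \<open>(C, w) \<mapsto> (C, kepler_lhs C w)\<close> is injective with invertible derivative, so the
  inverse function theorem differentiates its inverse \<open>(C, m) \<mapsto> (C, kepler_root C m)\<close>. The derivative is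
  a smooth expression in the root, hence the root is smooth.\<close>

lemma smooth_on_kepler_root: "smooth_on ({0<..} \<times> UNIV) (\<lambda>(C, m). kepler_root C m)"
proof -
  define U :: "(real \<times> real) set" where "U = {0<..} \<times> UNIV"
  define F where "F = (\<lambda>(C, w). (C, kepler_lhs C w))"
  define G where "G = (\<lambda>(C, m). (C, kepler_root C m))"
  define W where "W = (\<lambda>(C, m). kepler_root C m)"
  define den where "den = (\<lambda>(p :: real \<times> real) w. 1 + (1 / 2) * (exp w + fst p * exp (- w)) :: real)"
  define W' where "W' = (\<lambda>p d. (snd d + exp (- W p) * (fst d / 2)) * inverse (den p (W p)))"
  have "open U" unfolding U_def by (intro open_Times) auto
  have den_pos: "0 < den p w" if "p \<in> U" for p w
    using that by (auto simp: den_def U_def intro!: add_pos_pos)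
  define F' :: "real \<times> real \<Rightarrow> real \<times> real \<Rightarrow> real \<times> real"
    where "F' = (\<lambda>z d. (fst d, den z (snd z) * snd d - exp (- snd z) * (fst d / 2)))"
  have derF: "(F has_derivative F' z) (at z)" for z
    unfolding F_def F'_def den_def kepler_lhs_def case_prod_unfold
    by (auto intro!: derivative_eq_intros simp: fun_eq_iff field_simps)
  have derG: "(G has_derivative (\<lambda>d. (fst d, W' p d))) (at p)" if "p \<in> U" for p
  proof (rule has_derivative_inverse_strong_x[OF \<open>open U\<close>])
    have Gp: "G p = (fst p, W p)" by (simp add: G_def W_def case_prod_unfold)
    then show "G p \<in> U" using that by (simp add: U_def mem_Times_iff)
    show "continuous_on U F"
      using derF by (intro continuous_at_imp_continuous_on) (auto intro: has_derivative_continuous)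
    show "G (F y) = y" if "y \<in> U" for y
      using that by (auto simp: G_def F_def U_def intro: kepler_root_eqI)
    show "F (G p) = p" using that by (auto simp: G_def F_def U_def kepler_lhs_root)
    show "(F has_derivative F' (G p)) (at (G p))" by (rule derF)
    show "F' (G p) \<circ> (\<lambda>d. (fst d, W' p d)) = id"
    proof -
      have "den (G p) (W p) = den p (W p)" by (simp add: Gp den_def)
      then show ?thesis
        using den_pos[OF that, of "W p"] by (auto simp: fun_eq_iff W'_def F'_def Gp simp flip: divide_inverse)
    qed
  qed
  have "W = (\<lambda>p. snd (G p))" by (auto simp: W_def G_def)
  then have derW: "(W has_derivative W' p) (at p)" if "p \<in> U" for p
    using has_derivative_snd[OF derG[OF that]] by simp
  have "smooth_on U W"
  proof (rule smooth_on_bootstrap[OF \<open>open U\<close> derW])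
    fix n v assume W: "Ck_on n U W"
    have "smooth_on UNIV (\<lambda>w::real. exp w)" "smooth_on UNIV (\<lambda>w::real. exp (- w))"
      by (intro smooth_on_exp smooth_on_bounded_linear bounded_linear_minus bounded_linear_ident
          open_UNIV)+
    then have expW: "Ck_on n U (\<lambda>p. exp (W p))" "Ck_on n U (\<lambda>p. exp (- W p))"
      using W \<open>open U\<close> Ck_on_compose[of U UNIV W n "\<lambda>w. exp w"]
        Ck_on_compose[of U UNIV W n "\<lambda>w. exp (- w)"]
      by (simp_all add: smooth_on_def)
    have "Ck_on n U (\<lambda>p. den p (W p))"
      unfolding den_def using expW \<open>open U\<close>
      by (intro Ck_on_add Ck_on_const bounded_bilinear.Ck_on_prod[OF bounded_bilinear_mult]
          Ck_on_bounded_linear[OF _ bounded_linear_fst])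
    then have "Ck_on n U (\<lambda>p. inverse (den p (W p)))"
      using den_pos smooth_on_inverse_real \<open>open U\<close>
      by (intro Ck_on_compose[of U "{0<..}" _ n inverse]) (auto simp: smooth_on_def)
    moreover have "Ck_on n U (\<lambda>p. snd v + exp (- W p) * (fst v / 2))"
      using expW \<open>open U\<close>
      by (intro Ck_on_add Ck_on_const bounded_bilinear.Ck_on_prod[OF bounded_bilinear_mult])
    ultimately show "Ck_on n U (\<lambda>p. W' p v)"
      unfolding W'_def using \<open>open U\<close>
      by (intro bounded_bilinear.Ck_on_prod[OF bounded_bilinear_mult])
  qed
  then show ?thesis by (simp add: U_def W_def)
qed

section \<open>Asymptotic action and angle\<close>

text \<open>By conservation of energy this is the speed \<open>\<alpha>\<close> at infinity.\<close>

definition speed :: "real \<Rightarrow> phase \<Rightarrow> real"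
  where "speed q p = sqrt (kepler_H q p)"

text \<open>The parameter \<open>k = q / (2\<alpha>)\<close> is a multiple of the Sommerfeld parameter of Coulomb scattering.
  Every state satisfies \<open>\<alpha>|x| \<ge> 2k\<close>, with equality exactly when \<open>v = 0\<close>.\<close>

definition sommerfeld :: "real \<Rightarrow> real \<Rightarrow> real"
  where "sommerfeld q \<alpha> = q / (2 * \<alpha>)"

definition rho :: "real \<Rightarrow> phase \<Rightarrow> real"
  where "rho q p = fst p \<bullet> snd p + speed q p * norm (fst p)"

definition excess :: "real \<Rightarrow> phase \<Rightarrow> real"
  where "excess q p = rho q p - sommerfeld q (speed q p)"

text \<open>The formula comes from \<open>v = \<partial>S/\<partial>x = (1 + s) a + s \<alpha> x/|x|\<close>, where \<open>s\<close> is the derivative of the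
  profile of the eikonal. Pairing with \<open>x\<close> and using the eikonal equation gives \<open>s = - k / \<rho>\<close>.\<close>

definition action :: "real \<Rightarrow> phase \<Rightarrow> real^3"
  where "action q p = (rho q p / excess q p) *\<^sub>R snd p + (q / (2 * norm (fst p) * excess q p)) *\<^sub>R fst p"

text \<open>On an orbit \<open>x\<close> lags behind the uniform motion \<open>\<theta> + t a\<close> by this multiple of \<open>a\<close>, which grows
  like \<open>ln t\<close>, up to a bounded error.\<close>

definition delay :: "real \<Rightarrow> phase \<Rightarrow> real"
  where "delay q p = sommerfeld q (speed q p) / (speed q p)\<^sup>2 *
           (ln (excess q p / sommerfeld q (speed q p)) - speed q p * norm (fst p) / rho q p)"

definition angle :: "real \<Rightarrow> phase \<Rightarrow> real^3"
  where "angle q p = (excess q p / rho q p) *\<^sub>R fst p + delay q p *\<^sub>R action q p"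

text \<open>The functions \<open>d_\<dots>\<close> are the differentials of the quantities above at \<open>p\<close>, applied to a
  tangent vector. \<open>d_excess\<close> uses \<open>dk = - k d\<alpha> / \<alpha>\<close>, and the two coefficients in \<open>d_action\<close> and the
  prefactor in \<open>d_delay\<close> are differentiated logarithmically.\<close>

definition d_norm :: "phase \<Rightarrow> phase \<Rightarrow> real"
  where "d_norm p \<xi> = (fst p \<bullet> fst \<xi>) / norm (fst p)"

definition d_speed :: "real \<Rightarrow> phase \<Rightarrow> phase \<Rightarrow> real"
  where "d_speed q p \<xi> =
    (snd p \<bullet> snd \<xi> - q * d_norm p \<xi> / (2 * (norm (fst p))\<^sup>2)) / speed q p"

definition d_rho :: "real \<Rightarrow> phase \<Rightarrow> phase \<Rightarrow> real"
  where "d_rho q p \<xi> = fst p \<bullet> snd \<xi> + fst \<xi> \<bullet> snd p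
    + (speed q p * d_norm p \<xi> + d_speed q p \<xi> * norm (fst p))"

definition d_excess :: "real \<Rightarrow> phase \<Rightarrow> phase \<Rightarrow> real"
  where "d_excess q p \<xi> = d_rho q p \<xi> + sommerfeld q (speed q p) * d_speed q p \<xi> / speed q p"

definition d_action :: "real \<Rightarrow> phase \<Rightarrow> phase \<Rightarrow> real^3"
  where "d_action q p \<xi> =
     (rho q p / excess q p) *\<^sub>R snd \<xi>
     + (d_rho q p \<xi> / excess q p - rho q p * d_excess q p \<xi> / (excess q p)\<^sup>2) *\<^sub>R snd p
     + ((q / (2 * norm (fst p) * excess q p)) *\<^sub>R fst \<xi>
     + (- (q / (2 * norm (fst p) * excess q p)
         * (d_norm p \<xi> / norm (fst p) + d_excess q p \<xi> / excess q p))) *\<^sub>R fst p)"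

definition d_delay :: "real \<Rightarrow> phase \<Rightarrow> phase \<Rightarrow> real"
  where "d_delay q p \<xi> = - 3 * delay q p * d_speed q p \<xi> / speed q p
    + sommerfeld q (speed q p) / (speed q p)\<^sup>2 *
      (d_excess q p \<xi> / excess q p + d_speed q p \<xi> / speed q p
       - (d_speed q p \<xi> * norm (fst p) + speed q p * d_norm p \<xi>) / rho q p
       + speed q p * norm (fst p) * d_rho q p \<xi> / (rho q p)\<^sup>2)"

definition d_angle :: "real \<Rightarrow> phase \<Rightarrow> phase \<Rightarrow> real^3"
  where "d_angle q p \<xi> =
     (excess q p / rho q p) *\<^sub>R fst \<xi>
     + (d_excess q p \<xi> / rho q p - excess q p * d_rho q p \<xi> / (rho q p)\<^sup>2) *\<^sub>R fst p
     + (delay q p *\<^sub>R d_action q p \<xi> + d_delay q p \<xi> *\<^sub>R action q p)"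

definition kepler_field :: "real \<Rightarrow> phase \<Rightarrow> phase"
  where "kepler_field q p = (snd p, (q / 2) *\<^sub>R (fst p /\<^sub>R norm (fst p) ^ 3))"

text \<open>The scalar part of \<open>d\<Theta> \<and> dA\<close>. The arguments \<open>a\<close>, \<open>b\<close>, \<open>c\<close> of \<open>T\<close> stand for the values of
  \<open>d\<alpha>\<close>, \<open>d\<rho>\<close>, \<open>d|x|\<close> on a tangent vector, and the argument \<open>x\<close> for that of \<open>x \<bullet> dv\<close>. The number
  \<open>\<gamma>\<close> is the coefficient of \<open>d\<alpha>\<close> in the differential of the delay that contains the logarithm; it
  cancels since it multiplies \<open>d\<alpha> \<and> d\<alpha>\<close>. No relation between the values on the two tangent
  vectors enters, so the claim is an identity of rational functions.\<close>

lemma canonical_scalar_identity: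
  fixes \<alpha> r D k \<rho> \<gamma> A1 A2 P1 P2 R1 R2 X1 X2 :: real
  assumes pos: "\<alpha> > 0" "r > 0" "D > 0" "\<rho> > 0" and \<rho>: "\<rho> = D + k"
  defines "T \<equiv> \<lambda>a1 b1 c1 x1 a2 b2 c2 x2.
    (let e1 = b1 + k * a1 / \<alpha>; e2 = b2 + k * a2 / \<alpha>; m2 = b2 / D - \<rho> * e2 / D\<^sup>2;
         \<nu> = k * \<alpha> / (r * D); n2 = - (\<nu> * (c2 / r + e2 / D)) in
     (e1 / \<rho> - D * b1 / \<rho>\<^sup>2) * ((\<rho> / D) * x2 + m2 * (\<rho> - \<alpha> * r) + \<nu> * (r * c2) + n2 * (r * r))
     + (D / \<rho>) * (m2 * (b1 - x1 - (\<alpha> * c1 + a1 * r)) + n2 * (r * c1))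
     + (\<gamma> * a1 + k / \<alpha>\<^sup>2 * (e1 / D + a1 / \<alpha> - (a1 * r + \<alpha> * c1) / \<rho> + \<alpha> * r * b1 / \<rho>\<^sup>2)) * (\<alpha> * a2))"
  shows "T A1 P1 R1 X1 A2 P2 R2 X2 = T A2 P2 R2 X2 A1 P1 R1 X1"
  using pos unfolding T_def Let_def \<rho>
  by (simp add: divide_simps) (simp add: algebra_simps power2_eq_square)

context
  fixes q :: real and x v :: "real^3" and r \<alpha> k \<rho> D :: real and p :: phase
  assumes q: "q > 0" and x: "x \<noteq> 0"
  defines "r \<equiv> norm x" and "\<alpha> \<equiv> speed q (x, v)" and "k \<equiv> sommerfeld q \<alpha>"
    and "\<rho> \<equiv> rho q (x, v)" and "D \<equiv> excess q (x, v)" and "p \<equiv> (x, v)"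
begin

lemma r_pos: "r > 0" using x by (simp add: r_def)

lemma x_dot_x: "x \<bullet> x = r * r" by (simp add: r_def dot_square_norm power2_eq_square)

lemma kepler_H_pos: "kepler_H q (x, v) > 0"
  unfolding kepler_H_def using q x by (auto intro!: add_nonneg_pos divide_pos_pos)

lemma speed_pos: "\<alpha> > 0"
  using kepler_H_pos by (simp add: \<alpha>_def speed_def)

lemma sommerfeld_pos: "k > 0"
  using q speed_pos by (simp add: k_def sommerfeld_def)

lemma q_eq: "q = 2 * k * \<alpha>"
  using speed_pos by (simp add: k_def sommerfeld_def)

lemma v_dot_v: "v \<bullet> v = \<alpha>\<^sup>2 - 2 * k * \<alpha> / r"
  using kepler_H_pos unfolding q_eq[symmetric]
  by (simp add: \<alpha>_def speed_def kepler_H_def r_def dot_square_norm)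

lemma x_dot_v: "x \<bullet> v = \<rho> - \<alpha> * r"
  by (simp add: \<rho>_def rho_def \<alpha>_def r_def)

lemma rho_eq: "\<rho> = D + k"
  by (simp add: D_def excess_def \<rho>_def k_def \<alpha>_def)

text \<open>Since \<open>|v|\<^sup>2 \<ge> 0\<close>, the energy gives \<open>\<alpha>|x| \<ge> 2k\<close>, and Cauchy-Schwarz gives
  \<open>(x \<bullet> v)\<^sup>2 \<le> (\<alpha>|x| - k)\<^sup>2 - k\<^sup>2\<close>. So \<open>x \<bullet> v > k - \<alpha>|x|\<close>, even when \<open>x \<bullet> v\<close> is negative.\<close>

lemma excess_pos: "D > 0"
proof -
  have "0 \<le> v \<bullet> v" by simp
  then have *: "2 * k \<le> \<alpha> * r"
    using speed_pos r_pos by (simp add: v_dot_v field_simps power2_eq_square)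
  have "(x \<bullet> v)\<^sup>2 \<le> (x \<bullet> x) * (v \<bullet> v)" by (rule Cauchy_Schwarz_ineq)
  also have "\<dots> = (\<alpha> * r - k)\<^sup>2 - k\<^sup>2"
    using r_pos by (simp add: v_dot_v x_dot_x field_simps power2_eq_square)
  also have "\<dots> < (\<alpha> * r - k)\<^sup>2" using sommerfeld_pos by simp
  finally have "\<bar>x \<bullet> v\<bar> < \<alpha> * r - k"
    using * sommerfeld_pos by (intro power2_less_imp_less[of "\<bar>x \<bullet> v\<bar>"]) auto
  then show ?thesis using x_dot_v rho_eq by linarith
qed

lemma rho_pos: "\<rho> > 0"
  using excess_pos sommerfeld_pos by (simp add: rho_eq)

lemma action_eq: "action q (x, v) = (\<rho> / D) *\<^sub>R v + (k * \<alpha> / (r * D)) *\<^sub>R x"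
  unfolding action_def using q_eq by (simp add: \<rho>_def D_def r_def)

lemma action_dot_action: "action q (x, v) \<bullet> action q (x, v) = \<alpha>\<^sup>2"
proof -
  have "D * D * (action q (x, v) \<bullet> action q (x, v)) =
      \<rho>\<^sup>2 * (v \<bullet> v) + 2 * \<rho> * (k * \<alpha> / r) * (x \<bullet> v) + (k * \<alpha> / r)\<^sup>2 * (x \<bullet> x)"
    unfolding action_eq using excess_pos r_pos
    by (simp add: inner_simps inner_commute[of v x] field_simps power2_eq_square)
  also have "\<dots> = D * D * \<alpha>\<^sup>2"
    unfolding v_dot_v x_dot_v x_dot_x rho_eq using r_pos by (simp add: field_simps power2_eq_square)
  finally show ?thesis using excess_pos by simp
qed

lemma norm_action: "norm (action q (x, v)) = \<alpha>"
  using action_dot_action speed_pos by (simp add: norm_eq_sqrt_inner)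

lemma x_dot_action: "x \<bullet> action q (x, v) = \<rho>\<^sup>2 / D - \<alpha> * r"
  unfolding action_eq inner_add_right inner_scaleR_right x_dot_v x_dot_x rho_eq
  using r_pos excess_pos by (simp add: field_simps power2_eq_square)

text \<open>The right side grows at the constant rate \<open>\<alpha>\<^sup>2\<close> along an orbit: it is Kepler's equation, with
  \<open>ln (D / k)\<close> as the eccentric anomaly up to a constant of the motion.\<close>

lemma angle_dot_action: "angle q (x, v) \<bullet> action q (x, v) = x \<bullet> v + k * ln (D / k)"
proof -
  have "angle q (x, v) \<bullet> action q (x, v) =
      (D / \<rho>) * (\<rho>\<^sup>2 / D - \<alpha> * r) + k / \<alpha>\<^sup>2 * (ln (D / k) - \<alpha> * r / \<rho>) * \<alpha>\<^sup>2"
    by (simp add: angle_def delay_def inner_simps x_dot_action action_dot_action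
        flip: \<alpha>_def k_def D_def \<rho>_def r_def)
  also have "\<dots> = x \<bullet> v + k * ln (D / k)"
    unfolding x_dot_v using speed_pos excess_pos rho_pos
    by (simp add: field_simps power2_eq_square) (simp add: rho_eq algebra_simps)
  finally show ?thesis .
qed

lemma angle_cross_action: "cross3 (angle q (x, v)) (action q (x, v)) = cross3 x v"
proof -
  have "cross3 (angle q (x, v)) (action q (x, v)) = (D / \<rho>) *\<^sub>R cross3 x (action q (x, v))"
    by (simp add: angle_def cross_add_left cross_mult_left flip: D_def \<rho>_def)
  also have "\<dots> = (D / \<rho>) *\<^sub>R (\<rho> / D) *\<^sub>R cross3 x v"
    by (simp add: action_eq cross_add_right cross_mult_right)
  finally show ?thesis using rho_pos excess_pos by simp
qed

text \<open>This relation recovers \<open>|x|\<close> from \<open>\<rho>\<close> and the conserved quantities, which is what the inverse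
  transformation uses.\<close>

lemma norm_cross_x_v: "(norm (cross3 x v))\<^sup>2 = 2 * \<alpha> * r * D - \<rho>\<^sup>2"
proof -
  have "(norm (cross3 x v))\<^sup>2 = (x \<bullet> x) * (v \<bullet> v) - (x \<bullet> v)\<^sup>2"
    using norm_cross_dot[of x v] by (simp add: dot_square_norm power_mult_distrib)
  also have "\<dots> = 2 * \<alpha> * r * D - \<rho>\<^sup>2"
    unfolding x_dot_x v_dot_v x_dot_v rho_eq using r_pos
    by (simp add: field_simps power2_eq_square)
  finally show ?thesis .
qed

section \<open>Differentials of the action and the angle\<close>

lemma norm_has_derivative: "((\<lambda>p::phase. norm (fst p)) has_derivative d_norm p) (at p)"
proof -
  have "(norm has_derivative (\<lambda>h. h \<bullet> sgn (fst p))) (at (fst p))"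
    using x by (intro has_derivative_norm) (simp add: p_def)
  from has_derivative_compose[OF has_derivative_fst[OF has_derivative_ident] this]
  show ?thesis
    by (simp add: d_norm_def[abs_def] sgn_div_norm inverse_eq_divide inner_commute)
qed

lemma pos_at_p: "norm (fst p) > 0" "speed q p > 0" "excess q p > 0" "rho q p > 0"
  using x speed_pos excess_pos rho_pos by (simp_all add: p_def \<alpha>_def D_def \<rho>_def)

lemma speed_has_derivative: "(speed q has_derivative d_speed q p) (at p)"
proof -
  define H :: "phase \<Rightarrow> real" where "H = (\<lambda>z. snd z \<bullet> snd z + q / norm (fst z))"
  define H' :: "phase \<Rightarrow> real"
    where "H' = (\<lambda>\<xi>. 2 * (snd p \<bullet> snd \<xi>) - q * d_norm p \<xi> / (norm (fst p))\<^sup>2)"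
  have "(H has_derivative H') (at p)"
    using pos_at_p unfolding H_def H'_def
    by (auto intro!: derivative_eq_intros norm_has_derivative[THEN has_derivative_eq_rhs]
        simp: inner_commute power2_eq_square)
  moreover have sqrt: "speed q = (\<lambda>z. sqrt (H z))"
    by (auto simp: speed_def kepler_H_def fun_eq_iff dot_square_norm H_def)
  moreover have "H p > 0" using pos_at_p(2) by (simp add: sqrt)
  ultimately have "(speed q has_derivative (\<lambda>\<xi>. H' \<xi> * (inverse (speed q p) / 2))) (at p)"
    using DERIV_compose_FDERIV[OF DERIV_real_sqrt, of H p H'] by simp
  then show ?thesis
    by (rule has_derivative_eq_rhs)
       (use pos_at_p in \<open>auto simp: d_speed_def H'_def fun_eq_iff divide_simps\<close>)
qed

lemma rho_has_derivative: "(rho q has_derivative d_rho q p) (at p)"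
  unfolding rho_def[abs_def] d_rho_def[abs_def]
  by (intro has_derivative_add has_derivative_inner has_derivative_mult speed_has_derivative
      norm_has_derivative has_derivative_fst has_derivative_snd has_derivative_ident)

lemma excess_has_derivative: "(excess q has_derivative d_excess q p) (at p)"
  unfolding excess_def[abs_def] d_excess_def[abs_def] sommerfeld_def
  using pos_at_p
  by (auto intro!: derivative_eq_intros speed_has_derivative[THEN has_derivative_eq_rhs]
      rho_has_derivative[THEN has_derivative_eq_rhs] simp: field_simps)

lemma action_has_derivative: "(action q has_derivative d_action q p) (at p)"
proof -
  have "((\<lambda>p. rho q p / excess q p) has_derivative (\<lambda>\<xi>. d_rho q p \<xi> / excess q p
      - rho q p * d_excess q p \<xi> / (excess q p)\<^sup>2)) (at p)"
    using pos_at_p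
    by (auto intro!: derivative_eq_intros excess_has_derivative[THEN has_derivative_eq_rhs]
        rho_has_derivative[THEN has_derivative_eq_rhs]
        simp: field_simps power2_eq_square)
  moreover have "((\<lambda>p. q / (2 * norm (fst p) * excess q p)) has_derivative
      (\<lambda>\<xi>. - (q / (2 * norm (fst p) * excess q p)
         * (d_norm p \<xi> / norm (fst p) + d_excess q p \<xi> / excess q p)))) (at p)"
    using pos_at_p
    by (auto intro!: derivative_eq_intros excess_has_derivative[THEN has_derivative_eq_rhs]
        norm_has_derivative[THEN has_derivative_eq_rhs]
        simp: field_simps power2_eq_square)
  ultimately show ?thesis
    unfolding action_def[abs_def] d_action_def[abs_def]
    by (intro has_derivative_add has_derivative_scaleR has_derivative_fst has_derivative_snd
        has_derivative_ident)
qed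

lemma delay_has_derivative: "(delay q has_derivative d_delay q p) (at p)"
proof -
  let ?s = "\<lambda>p. sommerfeld q (speed q p) / (speed q p)\<^sup>2"
    and ?l = "\<lambda>p. ln (excess q p / sommerfeld q (speed q p))"
    and ?m = "\<lambda>p. speed q p * norm (fst p) / rho q p"
  note [derivative_intros] = speed_has_derivative norm_has_derivative rho_has_derivative
    excess_has_derivative
  have k: "sommerfeld q (speed q p) > 0" using pos_at_p q by (simp add: sommerfeld_def)
  have k': "((\<lambda>p. sommerfeld q (speed q p)) has_derivative
      (\<lambda>\<xi>. - sommerfeld q (speed q p) * d_speed q p \<xi> / speed q p)) (at p)"
    unfolding sommerfeld_def using pos_at_p
    by (auto intro!: derivative_eq_intros simp: field_simps)
  have s': "(?s has_derivative (\<lambda>\<xi>. - 3 * ?s p * d_speed q p \<xi> / speed q p)) (at p)"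
    using pos_at_p by (auto intro!: derivative_eq_intros k' simp: field_simps power2_eq_square)
  have l': "(?l has_derivative
      (\<lambda>\<xi>. d_excess q p \<xi> / excess q p + d_speed q p \<xi> / speed q p)) (at p)"
    using pos_at_p k by (auto intro!: derivative_eq_intros k' simp: field_simps power2_eq_square)
  have m': "(?m has_derivative
      (\<lambda>\<xi>. (d_speed q p \<xi> * norm (fst p) + speed q p * d_norm p \<xi>) / rho q p
       - speed q p * norm (fst p) * d_rho q p \<xi> / (rho q p)\<^sup>2)) (at p)"
    using pos_at_p by (auto intro!: derivative_eq_intros simp: field_simps power2_eq_square)
  have "(delay q has_derivative (\<lambda>\<xi>. ?s p * ((d_excess q p \<xi> / excess q p + d_speed q p \<xi> / speed q p)
      - ((d_speed q p \<xi> * norm (fst p) + speed q p * d_norm p \<xi>) / rho q p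
       - speed q p * norm (fst p) * d_rho q p \<xi> / (rho q p)\<^sup>2))
     + (- 3 * ?s p * d_speed q p \<xi> / speed q p) * (?l p - ?m p))) (at p)"
    unfolding delay_def[abs_def] by (intro has_derivative_mult has_derivative_diff s' l' m')
  moreover have "s * ((a + b) - (c - d)) + (- 3 * s * e / f) * y
      = - 3 * (s * y) * e / f + s * (a + b - c + d)" for s a b c d e f y :: real
    by (simp add: algebra_simps)
  ultimately show ?thesis
    by (simp only: d_delay_def[abs_def] delay_def[of q p])
qed

lemma angle_has_derivative: "(angle q has_derivative d_angle q p) (at p)"
proof -
  have "((\<lambda>p. excess q p / rho q p) has_derivative (\<lambda>\<xi>. d_excess q p \<xi> / rho q p
      - excess q p * d_rho q p \<xi> / (rho q p)\<^sup>2)) (at p)"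
    using pos_at_p
    by (auto intro!: derivative_eq_intros excess_has_derivative[THEN has_derivative_eq_rhs]
        rho_has_derivative[THEN has_derivative_eq_rhs]
        simp: field_simps power2_eq_square)
  then show ?thesis
    unfolding angle_def[abs_def] d_angle_def[abs_def]
    by (intro has_derivative_add has_derivative_scaleR action_has_derivative delay_has_derivative
        has_derivative_fst has_derivative_ident)
qed

section \<open>Canonicity\<close>

lemma x_dot_fst: "x \<bullet> fst \<xi> = r * d_norm p \<xi>"
  using r_pos by (simp add: d_norm_def p_def r_def)

lemma fst_dot_v: "fst \<xi> \<bullet> v = d_rho q p \<xi> - x \<bullet> snd \<xi> - (\<alpha> * d_norm p \<xi> + d_speed q p \<xi> * r)"
  by (simp add: d_rho_def p_def r_def \<alpha>_def)

lemma v_dot_snd: "v \<bullet> snd \<xi> = \<alpha> * d_speed q p \<xi> + k * \<alpha> * d_norm p \<xi> / r\<^sup>2"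
proof -
  have "d_speed q p \<xi> = (v \<bullet> snd \<xi> - q * d_norm p \<xi> / (2 * r\<^sup>2)) / \<alpha>"
    by (simp add: d_speed_def p_def \<alpha>_def r_def)
  moreover have "q * d_norm p \<xi> / (2 * r\<^sup>2) = k * \<alpha> * d_norm p \<xi> / r\<^sup>2" using q_eq by simp
  ultimately show ?thesis using speed_pos by simp
qed

lemma d_excess_eq: "d_excess q p \<xi> = d_rho q p \<xi> + k * d_speed q p \<xi> / \<alpha>"
  by (simp add: d_excess_def k_def \<alpha>_def p_def)

definition d_coeff_v where "d_coeff_v \<xi> = d_rho q p \<xi> / D - \<rho> * d_excess q p \<xi> / D\<^sup>2"

definition d_coeff_x where "d_coeff_x \<xi> = - (k * \<alpha> / (r * D) * (d_norm p \<xi> / r + d_excess q p \<xi> / D))"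

lemma d_action_eq: "d_action q p \<xi> = (\<rho> / D) *\<^sub>R snd \<xi> + d_coeff_v \<xi> *\<^sub>R v
      + ((k * \<alpha> / (r * D)) *\<^sub>R fst \<xi> + d_coeff_x \<xi> *\<^sub>R x)"
proof -
  have "q / (2 * r * D) = k * \<alpha> / (r * D)" using q_eq by simp
  then show ?thesis
    unfolding d_action_def d_coeff_v_def d_coeff_x_def by (simp add: p_def flip: r_def \<rho>_def D_def)
qed

lemma x_dot_d_action: "x \<bullet> d_action q p \<xi> = (\<rho> / D) * (x \<bullet> snd \<xi>) + d_coeff_v \<xi> * (\<rho> - \<alpha> * r)
      + (k * \<alpha> / (r * D)) * (r * d_norm p \<xi>) + d_coeff_x \<xi> * (r * r)"
  unfolding d_action_eq inner_add_right inner_scaleR_right x_dot_fst by (simp add: x_dot_x x_dot_v)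

lemma fst_dot_d_action: "fst \<xi> \<bullet> d_action q p \<zeta> = (\<rho> / D) * (fst \<xi> \<bullet> snd \<zeta>)
      + (k * \<alpha> / (r * D)) * (fst \<xi> \<bullet> fst \<zeta>)
      + (d_coeff_v \<zeta> * (d_rho q p \<xi> - x \<bullet> snd \<xi> - (\<alpha> * d_norm p \<xi> + d_speed q p \<xi> * r))
         + d_coeff_x \<zeta> * (r * d_norm p \<xi>))"
  unfolding d_action_eq inner_add_right inner_scaleR_right fst_dot_v inner_commute[of _ x] x_dot_fst
  by simp

text \<open>The differential of \<open>|A|\<^sup>2 = \<alpha>\<^sup>2\<close>, halved.\<close>

lemma action_dot_d_action: "action q p \<bullet> d_action q p \<xi> = \<alpha> * d_speed q p \<xi>"
proof -
  note pos = r_pos speed_pos excess_pos rho_pos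
  have "action q p \<bullet> d_action q p \<xi> = (\<rho> / D) * (v \<bullet> d_action q p \<xi>)
      + (k * \<alpha> / (r * D)) * (x \<bullet> d_action q p \<xi>)"
    using action_eq by (simp add: p_def inner_add_left)
  also have "v \<bullet> d_action q p \<xi> = (\<rho> / D) * (\<alpha> * d_speed q p \<xi> + k * \<alpha> * d_norm p \<xi> / r\<^sup>2)
      + d_coeff_v \<xi> * (\<alpha>\<^sup>2 - 2 * k * \<alpha> / r)
      + ((k * \<alpha> / (r * D)) * (d_rho q p \<xi> - x \<bullet> snd \<xi> - (\<alpha> * d_norm p \<xi> + d_speed q p \<xi> * r))
      + d_coeff_x \<xi> * (\<rho> - \<alpha> * r))"
    unfolding d_action_eq inner_add_right inner_scaleR_right v_dot_snd v_dot_v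
      inner_commute[of v "fst \<xi>"] fst_dot_v inner_commute[of v x] x_dot_v ..
  finally show ?thesis
    unfolding x_dot_d_action d_coeff_v_def d_coeff_x_def d_excess_eq rho_eq using pos(1-3)
    by (simp add: divide_simps) (simp add: algebra_simps power2_eq_square)
qed

lemma d_delay_eq: "d_delay q p \<xi> = - 3 * delay q p / \<alpha> * d_speed q p \<xi> + k / \<alpha>\<^sup>2 *
      (d_excess q p \<xi> / D + d_speed q p \<xi> / \<alpha> - (d_speed q p \<xi> * r + \<alpha> * d_norm p \<xi>) / \<rho>
       + \<alpha> * r * d_rho q p \<xi> / \<rho>\<^sup>2)"
  by (simp add: d_delay_def k_def \<alpha>_def p_def D_def r_def \<rho>_def)

text \<open>Write \<open>A = \<mu> v + \<nu> x\<close> and \<open>\<Theta> = \<lambda> x + \<delta> A\<close>, where \<open>\<delta>\<close> is the delay. In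
  \<open>d\<Theta> \<and> dA = \<lambda> dx \<and> dA + d\<lambda> \<and> (x \<bullet> dA) + \<delta> dA \<and> dA + d\<delta> \<and> (A \<bullet> dA)\<close> the
  term \<open>dA \<and> dA\<close> vanishes, \<open>A \<bullet> dA = \<alpha> d\<alpha>\<close>, and \<open>\<lambda> dx \<and> dA\<close> contributes
  \<open>\<lambda> \<mu> dx \<and> dv = dx \<and> dv\<close> and a multiple of \<open>dx \<and> dx = 0\<close>. What remains, \<open>\<tau>\<close> in the proof,
  involves only \<open>x \<bullet> dv\<close> and the differentials of \<open>\<alpha>\<close>, \<open>\<rho>\<close> and \<open>|x|\<close>.\<close>

lemma angle_action_canonical:
  "d_angle q p \<xi> \<bullet> d_action q p \<zeta> - d_angle q p \<zeta> \<bullet> d_action q p \<xi> =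
   fst \<xi> \<bullet> snd \<zeta> - fst \<zeta> \<bullet> snd \<xi>"
proof -
  note pos = r_pos speed_pos excess_pos rho_pos
  define \<tau> where "\<tau> \<eta> \<theta> =
      (d_excess q p \<eta> / \<rho> - D * d_rho q p \<eta> / \<rho>\<^sup>2) * (x \<bullet> d_action q p \<theta>)
      + (D / \<rho>) * (d_coeff_v \<theta> * (d_rho q p \<eta> - x \<bullet> snd \<eta> - (\<alpha> * d_norm p \<eta> + d_speed q p \<eta> * r))
         + d_coeff_x \<theta> * (r * d_norm p \<eta>))
      + d_delay q p \<eta> * (\<alpha> * d_speed q p \<theta>)" for \<eta> \<theta>
  have split: "d_angle q p \<eta> \<bullet> d_action q p \<theta> =
      (fst \<eta> \<bullet> snd \<theta>) + (D / \<rho>) * (k * \<alpha> / (r * D)) * (fst \<eta> \<bullet> fst \<theta>)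
      + delay q p * (d_action q p \<eta> \<bullet> d_action q p \<theta>) + \<tau> \<eta> \<theta>" for \<eta> \<theta>
  proof -
    have "d_angle q p \<eta> \<bullet> d_action q p \<theta> = (D / \<rho>) * (fst \<eta> \<bullet> d_action q p \<theta>)
      + (d_excess q p \<eta> / \<rho> - D * d_rho q p \<eta> / \<rho>\<^sup>2) * (x \<bullet> d_action q p \<theta>)
      + (delay q p * (d_action q p \<eta> \<bullet> d_action q p \<theta>)
      + d_delay q p \<eta> * (action q p \<bullet> d_action q p \<theta>))"
      unfolding d_angle_def by (simp add: inner_add_left p_def D_def \<rho>_def)
    moreover have "(D / \<rho>) * ((\<rho> / D) * (fst \<eta> \<bullet> snd \<theta>)) = fst \<eta> \<bullet> snd \<theta>"
      using pos by simp
    ultimately show ?thesis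
      unfolding action_dot_d_action fst_dot_d_action distrib_left[of "D / \<rho>"] \<tau>_def by simp
  qed
  have "\<tau> \<xi> \<zeta> = \<tau> \<zeta> \<xi>"
    using canonical_scalar_identity[OF pos(2,1,3,4) rho_eq,
        where ?A1.0 = "d_speed q p \<xi>" and ?P1.0 = "d_rho q p \<xi>" and ?R1.0 = "d_norm p \<xi>"
          and ?X1.0 = "x \<bullet> snd \<xi>" and ?A2.0 = "d_speed q p \<zeta>" and ?P2.0 = "d_rho q p \<zeta>"
          and ?R2.0 = "d_norm p \<zeta>" and ?X2.0 = "x \<bullet> snd \<zeta>" and \<gamma> = "- 3 * delay q p / \<alpha>"]
    unfolding Let_def \<tau>_def x_dot_d_action d_delay_eq d_coeff_v_def d_coeff_x_def d_excess_eq .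
  then show ?thesis
    by (simp add: split inner_commute[of "fst \<zeta>" "fst \<xi>"]
      inner_commute[of "d_action q p \<zeta>" "d_action q p \<xi>"])
qed

section \<open>The Kepler vector field\<close>

text \<open>\<open>\<alpha>\<close> is conserved and \<open>d\<rho>/dt = \<alpha> D / |x|\<close>; with these two rates the derivatives of both
  maps reduce to algebra.\<close>

lemma along_flow:
  shows "d_action q p (kepler_field q p) = 0" and "d_angle q p (kepler_field q p) = action q p"
proof -
  define K where "K = kepler_field q p"
  note pos = r_pos speed_pos excess_pos rho_pos
  have K: "fst K = v" "snd K = (k * \<alpha> / r ^ 3) *\<^sub>R x"
  proof -
    have "q / 2 = k * \<alpha>" using q_eq by linarith
    then have "(k * \<alpha> / r ^ 3) *\<^sub>R x = (q / 2) *\<^sub>R (x /\<^sub>R r ^ 3)"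
      by (simp only: scaleR_scaleR divide_inverse)
    then show "fst K = v" "snd K = (k * \<alpha> / r ^ 3) *\<^sub>R x"
      by (simp_all only: K_def kepler_field_def p_def r_def fst_conv snd_conv)
  qed
  have n: "d_norm p K = (\<rho> - \<alpha> * r) / r"
    unfolding d_norm_def K by (simp add: p_def x_dot_v r_def)
  have "\<alpha> * d_speed q p K = 0"
    using v_dot_snd[of K] pos unfolding K n
    by (simp add: inner_commute[of v x] x_dot_v power2_eq_square power3_eq_cube mult.assoc)
  then have s: "d_speed q p K = 0" using pos by simp
  have "d_rho q p K = v \<bullet> v + k * \<alpha> / r ^ 3 * (x \<bullet> x) + \<alpha> * d_norm p K"
    using fst_dot_v[of K] unfolding K s by simp
  also have "\<dots> = \<alpha> * D / r"
    unfolding v_dot_v x_dot_x n rho_eq using pos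
    by (simp add: field_simps power2_eq_square power3_eq_cube)
  finally have d: "d_rho q p K = \<alpha> * D / r" .
  have e: "d_excess q p K = \<alpha> * D / r" by (simp add: d_excess_eq d s)
  have "d_coeff_v K + k * \<alpha> / (r * D) = 0" "\<rho> / D * (k * \<alpha> / r ^ 3) + d_coeff_x K = 0"
    unfolding d_coeff_v_def d_coeff_x_def d e n using pos
    by (simp_all add: rho_eq divide_simps) (simp_all add: algebra_simps power2_eq_square power3_eq_cube)
  moreover have "d_action q p K = (d_coeff_v K + k * \<alpha> / (r * D)) *\<^sub>R v
      + (\<rho> / D * (k * \<alpha> / r ^ 3) + d_coeff_x K) *\<^sub>R x"
    unfolding d_action_eq K by (simp add: scaleR_add_left)
  ultimately have dA: "d_action q p K = 0" by simp
  then show "d_action q p (kepler_field q p) = 0" by (simp only: K_def)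
  have "d_delay q p K = k / \<alpha>\<^sup>2 * (\<alpha> * D / r / D - \<alpha> * ((\<rho> - \<alpha> * r) / r) / \<rho>
      + \<alpha> * r * (\<alpha> * D / r) / \<rho>\<^sup>2)"
    unfolding d_delay_eq d e n s by simp
  also have "\<dots> = k * (\<rho> + D) / \<rho>\<^sup>2"
    unfolding rho_eq using pos sommerfeld_pos
    by (simp add: divide_simps add_pos_pos[THEN less_imp_neq, symmetric]) (simp add: algebra_simps power2_eq_square)
  finally have dd: "d_delay q p K = k * (\<rho> + D) / \<rho>\<^sup>2" .
  have A: "action q p = (\<rho> / D) *\<^sub>R v + (k * \<alpha> / (r * D)) *\<^sub>R x"
    using action_eq by (simp add: p_def)
  have "d_angle q p K = (D / \<rho>) *\<^sub>R v + (\<alpha> * D / r / \<rho> - D * (\<alpha> * D / r) / \<rho>\<^sup>2) *\<^sub>R x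
      + (k * (\<rho> + D) / \<rho>\<^sup>2) *\<^sub>R action q p"
    unfolding d_angle_def dA d e dd by (simp add: p_def K flip: \<rho>_def D_def)
  also have "(D / \<rho>) *\<^sub>R v + (\<alpha> * D / r / \<rho> - D * (\<alpha> * D / r) / \<rho>\<^sup>2) *\<^sub>R x = (D / \<rho>)\<^sup>2 *\<^sub>R action q p"
  proof -
    have "(D / \<rho>)\<^sup>2 * (\<rho> / D) = D / \<rho>"
      "(D / \<rho>)\<^sup>2 * (k * \<alpha> / (r * D)) = \<alpha> * D / r / \<rho> - D * (\<alpha> * D / r) / \<rho>\<^sup>2"
      using pos by (simp_all add: field_simps power2_eq_square) (simp add: rho_eq algebra_simps)
    then show ?thesis by (simp add: A scaleR_add_right)
  qed
  also have "(D / \<rho>)\<^sup>2 *\<^sub>R action q p + (k * (\<rho> + D) / \<rho>\<^sup>2) *\<^sub>R action q p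
      = ((D / \<rho>)\<^sup>2 + k * (\<rho> + D) / \<rho>\<^sup>2) *\<^sub>R action q p"
    by (simp add: scaleR_add_left)
  also have "(D / \<rho>)\<^sup>2 + k * (\<rho> + D) / \<rho>\<^sup>2 = 1"
    using pos by (simp add: field_simps power2_eq_square) (simp add: rho_eq algebra_simps)
  finally show "d_angle q p (kepler_field q p) = action q p" by (simp add: K_def)
qed

end

section \<open>The inverse transformation\<close>

text \<open>Lagrange's identity makes this \<open>|\<theta> \<times> a|\<^sup>2\<close>, the squared angular momentum.\<close>

definition ang_sq :: "phase \<Rightarrow> real"
  where "ang_sq y = (norm (fst y))\<^sup>2 * (norm (snd y))\<^sup>2 - (fst y \<bullet> snd y)\<^sup>2"

text \<open>The number \<open>w = ln (D / k)\<close>. The definitions below express \<open>D\<close>, \<open>\<rho>\<close>, \<open>|x|\<close>, the delay, \<open>x\<close> and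
  \<open>v\<close> in terms of it.\<close>

definition inv_w :: "real \<Rightarrow> phase \<Rightarrow> real"
  where "inv_w q y = (let k = sommerfeld q (norm (snd y)) in
           kepler_root (1 + ang_sq y / k\<^sup>2) (fst y \<bullet> snd y / k))"

definition inv_excess :: "real \<Rightarrow> phase \<Rightarrow> real"
  where "inv_excess q y = sommerfeld q (norm (snd y)) * exp (inv_w q y)"

definition inv_rho :: "real \<Rightarrow> phase \<Rightarrow> real"
  where "inv_rho q y = inv_excess q y + sommerfeld q (norm (snd y))"

definition inv_r :: "real \<Rightarrow> phase \<Rightarrow> real"
  where "inv_r q y = (ang_sq y + (inv_rho q y)\<^sup>2) / (2 * norm (snd y) * inv_excess q y)"

definition inv_delay :: "real \<Rightarrow> phase \<Rightarrow> real"
  where "inv_delay q y = sommerfeld q (norm (snd y)) / (norm (snd y))\<^sup>2 *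
           (inv_w q y - norm (snd y) * inv_r q y / inv_rho q y)"

definition inv_x :: "real \<Rightarrow> phase \<Rightarrow> real^3"
  where "inv_x q y = (inv_rho q y / inv_excess q y) *\<^sub>R (fst y - inv_delay q y *\<^sub>R snd y)"

definition inv_v :: "real \<Rightarrow> phase \<Rightarrow> real^3"
  where "inv_v q y = (inv_excess q y / inv_rho q y) *\<^sub>R snd y
           - (q / (2 * inv_r q y * inv_rho q y)) *\<^sub>R inv_x q y"

lemma ang_sq_nonneg: "ang_sq y \<ge> 0"
  using Cauchy_Schwarz_ineq[of "fst y" "snd y"] by (simp add: ang_sq_def dot_square_norm)

text \<open>This form shows that moving \<open>\<theta>\<close> along \<open>a\<close> changes nothing.\<close>

lemma ang_sq_cross: "ang_sq y = (norm (cross3 (fst y) (snd y)))\<^sup>2"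
  using norm_cross_dot[of "fst y" "snd y"] by (simp add: ang_sq_def power_mult_distrib)

lemma kepler_lhs_inv_w:
  assumes "q > 0" "snd y \<noteq> 0"
  shows "kepler_lhs (1 + ang_sq y / (sommerfeld q (norm (snd y)))\<^sup>2) (inv_w q y)
    = fst y \<bullet> snd y / sommerfeld q (norm (snd y))"
  unfolding inv_w_def Let_def using assms ang_sq_nonneg[of y]
  by (intro kepler_lhs_root add_pos_nonneg divide_nonneg_nonneg) auto

context
  fixes q :: real and \<theta> a x v :: "real^3" and r \<alpha> k \<rho> D L w \<delta> :: real
  assumes q: "q > 0" and a: "a \<noteq> 0"
  defines "r \<equiv> inv_r q (\<theta>, a)" and "\<alpha> \<equiv> norm a" and "k \<equiv> sommerfeld q \<alpha>"
    and "\<rho> \<equiv> inv_rho q (\<theta>, a)" and "D \<equiv> inv_excess q (\<theta>, a)" and "L \<equiv> ang_sq (\<theta>, a)"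
    and "w \<equiv> inv_w q (\<theta>, a)" and "\<delta> \<equiv> inv_delay q (\<theta>, a)"
    and "x \<equiv> inv_x q (\<theta>, a)" and "v \<equiv> inv_v q (\<theta>, a)"
begin

lemma inv_pos: "\<alpha> > 0" "k > 0" "D > 0" "\<rho> > 0" "L \<ge> 0"
proof -
  show \<alpha>: "\<alpha> > 0" using a by (simp add: \<alpha>_def)
  show k: "k > 0" using q \<alpha> by (simp add: k_def sommerfeld_def)
  show D: "D > 0" using k by (simp add: D_def inv_excess_def flip: k_def \<alpha>_def)
  show "\<rho> > 0" using k D by (simp add: \<rho>_def inv_rho_def flip: k_def \<alpha>_def D_def)
  show "L \<ge> 0" by (simp add: L_def ang_sq_nonneg)
qed

lemma inv_rho_eq: "\<rho> = D + k"
  by (simp add: \<rho>_def inv_rho_def D_def k_def \<alpha>_def)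

lemma inv_excess_eq: "D = k * exp w"
  by (simp add: inv_excess_def D_def k_def \<alpha>_def w_def)

lemma inv_r_eq: "\<alpha> * r = (L + \<rho>\<^sup>2) / (2 * D)"
  using inv_pos by (simp add: r_def inv_r_def flip: L_def \<rho>_def D_def \<alpha>_def)

lemma inv_r_pos: "r > 0"
proof -
  have "\<alpha> * r > 0" unfolding inv_r_eq using inv_pos by (simp add: add_nonneg_pos)
  then show ?thesis using inv_pos(1) by (simp add: zero_less_mult_iff)
qed

lemma L_eq: "L = 2 * \<alpha> * r * D - \<rho>\<^sup>2"
  using inv_r_eq inv_pos by (simp add: field_simps)

lemma inv_delay_eq: "\<delta> = k / \<alpha>\<^sup>2 * (w - \<alpha> * r / \<rho>)"
  by (simp add: \<delta>_def inv_delay_def k_def \<alpha>_def w_def r_def \<rho>_def)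

text \<open>Kepler's equation, which defines \<open>w\<close>, rewritten in the form of \<open>angle_dot_action\<close>.\<close>

lemma theta_dot_a: "\<theta> \<bullet> a = \<rho> - \<alpha> * r + k * w"
proof -
  have "w + (exp w - (1 + L / k\<^sup>2) * exp (- w)) / 2 = \<theta> \<bullet> a / k"
    using kepler_lhs_inv_w[OF q, of "(\<theta>, a)"] a
    by (simp add: kepler_lhs_def L_def k_def \<alpha>_def w_def)
  moreover have "exp w = D / k" "exp (- w) = k / D"
    using inv_pos inv_excess_eq by (simp_all add: exp_minus field_simps)
  ultimately have "\<theta> \<bullet> a = k * (w + (D / k - (1 + L / k\<^sup>2) * (k / D)) / 2)"
    using inv_pos by (simp add: field_simps)
  also have "\<dots> = \<rho> - (L + \<rho>\<^sup>2) / (2 * D) + k * w"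
    unfolding inv_rho_eq using inv_pos by (simp add: divide_simps) (simp add: algebra_simps power2_eq_square)
  finally show ?thesis by (simp add: inv_r_eq)
qed

lemma x_eq: "x = (\<rho> / D) *\<^sub>R (\<theta> - \<delta> *\<^sub>R a)"
  by (simp add: x_def inv_x_def \<rho>_def D_def \<delta>_def)

lemma a_dot_a: "a \<bullet> a = \<alpha>\<^sup>2"
  by (simp add: \<alpha>_def dot_square_norm)

lemma shift_dot_a: "(\<theta> - \<delta> *\<^sub>R a) \<bullet> a = \<rho> - \<alpha> * r * D / \<rho>"
  unfolding inner_diff_left inner_scaleR_left a_dot_a theta_dot_a inv_delay_eq
  using inv_pos by (simp add: divide_simps) (simp add: inv_rho_eq algebra_simps)

lemma inv_x_dot_a: "x \<bullet> a = \<rho>\<^sup>2 / D - \<alpha> * r"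
  unfolding x_eq inner_scaleR_left shift_dot_a
  using inv_pos by (simp add: field_simps power2_eq_square)

text \<open>The component of \<open>\<theta> - \<delta> a\<close> along \<open>a\<close> is \<open>shift_dot_a\<close>, and the component across \<open>a\<close> is
  that of \<open>\<theta>\<close>, measured by \<open>L\<close>. So the length of \<open>x\<close> is the radius that was computed beforehand.\<close>

lemma inv_x_dot_x: "x \<bullet> x = r\<^sup>2"
proof -
  have "\<alpha>\<^sup>2 * ((\<theta> - \<delta> *\<^sub>R a) \<bullet> (\<theta> - \<delta> *\<^sub>R a)) = ((\<theta> - \<delta> *\<^sub>R a) \<bullet> a)\<^sup>2 + L"
    unfolding L_def ang_sq_def a_dot_a[symmetric] power2_norm_eq_inner
    by (simp add: inner_simps inner_commute[of a \<theta>] power2_eq_square algebra_simps)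
  also have "\<dots> = (\<rho> - \<alpha> * r * D / \<rho>)\<^sup>2 + (2 * \<alpha> * r * D - \<rho>\<^sup>2)"
    unfolding shift_dot_a L_eq ..
  also have "\<dots> = (\<alpha> * r * D / \<rho>)\<^sup>2"
    using inv_pos by (simp add: field_simps power2_eq_square)
  finally have u: "\<alpha>\<^sup>2 * ((\<theta> - \<delta> *\<^sub>R a) \<bullet> (\<theta> - \<delta> *\<^sub>R a)) = (\<alpha> * r * D / \<rho>)\<^sup>2" .
  have "\<alpha>\<^sup>2 * (x \<bullet> x) = (\<rho> / D)\<^sup>2 * (\<alpha>\<^sup>2 * ((\<theta> - \<delta> *\<^sub>R a) \<bullet> (\<theta> - \<delta> *\<^sub>R a)))"
    unfolding x_eq by (simp add: power2_eq_square)
  then have "\<alpha>\<^sup>2 * (x \<bullet> x) = (\<rho> / D)\<^sup>2 * (\<alpha> * r * D / \<rho>)\<^sup>2" unfolding u .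
  then show ?thesis using inv_pos by (simp add: field_simps power2_eq_square)
qed

lemma norm_inv_x: "norm x = r"
  using inv_x_dot_x inv_r_pos by (simp add: norm_eq_sqrt_inner)

lemma inv_q_eq: "q = 2 * k * \<alpha>"
  using inv_pos by (simp add: k_def sommerfeld_def)

lemma v_eq: "v = (D / \<rho>) *\<^sub>R a - (k * \<alpha> / (r * \<rho>)) *\<^sub>R x"
proof -
  have "q / (2 * r * \<rho>) = k * \<alpha> / (r * \<rho>)" using inv_q_eq by simp
  then show ?thesis
    unfolding v_def inv_v_def by (simp flip: r_def \<rho>_def D_def x_def)
qed

lemma inv_x_dot_v: "x \<bullet> v = \<rho> - \<alpha> * r"
  unfolding v_eq inner_diff_right inner_scaleR_right inv_x_dot_a inv_x_dot_x
  using inv_pos inv_r_pos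
  by (simp add: divide_simps) (simp add: inv_rho_eq algebra_simps power2_eq_square)

lemma inv_v_dot_v: "v \<bullet> v = \<alpha>\<^sup>2 - 2 * k * \<alpha> / r"
proof -
  have "v \<bullet> v = (D / \<rho>)\<^sup>2 * \<alpha>\<^sup>2 - 2 * (D / \<rho>) * (k * \<alpha> / (r * \<rho>)) * (\<rho>\<^sup>2 / D - \<alpha> * r)
      + (k * \<alpha> / (r * \<rho>))\<^sup>2 * r\<^sup>2"
    unfolding v_eq a_dot_a[symmetric] inv_x_dot_a[symmetric] inv_x_dot_x[symmetric]
    by (simp add: inner_simps inner_commute[of a x] power2_eq_square algebra_simps)
  also have "\<dots> = \<alpha>\<^sup>2 - 2 * k * \<alpha> / r"
    using inv_pos inv_r_pos
    by (simp add: divide_simps) (simp add: inv_rho_eq algebra_simps power2_eq_square)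
  finally show ?thesis .
qed

text \<open>The inner products of \<open>x\<close> and \<open>v\<close> show that \<open>\<alpha>\<close>, \<open>\<rho>\<close> and \<open>D\<close> computed from \<open>(x, v)\<close> are
  those computed from \<open>(\<theta>, a)\<close>. The defining formulas for the action and the angle are then linear
  in the vectors and undo those for \<open>v\<close> and \<open>x\<close>.\<close>

lemma forward_inverse:
  "x \<noteq> 0" "action q (x, v) = a" "angle q (x, v) = \<theta>"
proof -
  show x: "x \<noteq> 0" using norm_inv_x inv_r_pos by auto
  have "kepler_H q (x, v) = v \<bullet> v + q / r"
    by (simp add: kepler_H_def norm_inv_x dot_square_norm)
  also have "q / r = 2 * k * \<alpha> / r" using inv_q_eq by simp
  finally have "kepler_H q (x, v) = \<alpha>\<^sup>2" by (simp add: inv_v_dot_v)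
  then have speed: "speed q (x, v) = \<alpha>" using inv_pos by (simp add: speed_def)
  then have rho: "rho q (x, v) = \<rho>" by (simp add: rho_def inv_x_dot_v norm_inv_x)
  then have excess: "excess q (x, v) = D"
    using speed by (simp add: excess_def inv_rho_eq flip: k_def)
  have "action q (x, v) = (\<rho> / D) *\<^sub>R v + (k * \<alpha> / (r * D)) *\<^sub>R x"
    using action_eq[OF q x, of v] by (simp add: rho excess speed norm_inv_x k_def)
  also have "\<dots> = (\<rho> / D * (D / \<rho>)) *\<^sub>R a + (k * \<alpha> / (r * D) - \<rho> / D * (k * \<alpha> / (r * \<rho>))) *\<^sub>R x"
    unfolding v_eq by (simp add: algebra_simps)
  also have "\<dots> = a" using inv_pos by simp
  finally show a': "action q (x, v) = a" .
  have "ln (D / k) = w" using inv_pos by (simp add: inv_excess_eq)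
  then have delay: "delay q (x, v) = \<delta>"
    unfolding delay_def inv_delay_eq speed rho excess by (simp add: norm_inv_x flip: k_def)
  have "angle q (x, v) = (D / \<rho>) *\<^sub>R x + \<delta> *\<^sub>R a"
    by (simp add: angle_def rho excess delay a')
  also have "\<dots> = \<theta>" unfolding x_eq using inv_pos by (simp add: algebra_simps)
  finally show "angle q (x, v) = \<theta>" .
qed

end

text \<open>By \<open>angle_dot_action\<close> and \<open>norm_cross_x_v\<close> the number \<open>ln (D / k)\<close> solves the same equation as
  \<open>inv_w\<close>, hence equals it, and the other quantities follow one after another.\<close>

lemma inverse_forward:
  fixes x v :: "real^3"
  assumes q: "q > 0" and x: "x \<noteq> 0"
  defines "y \<equiv> (angle q (x, v), action q (x, v))"
  shows "inv_x q y = x" "inv_v q y = v"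
proof -
  define r where "r = norm x"
  define \<alpha> where "\<alpha> = speed q (x, v)"
  define k where "k = sommerfeld q \<alpha>"
  define \<rho> where "\<rho> = rho q (x, v)"
  define D where "D = excess q (x, v)"
  note defs = r_def \<alpha>_def k_def \<rho>_def D_def
  have pos: "r > 0" "\<alpha> > 0" "k > 0" "D > 0" "\<rho> > 0"
    using r_pos[OF q x] speed_pos[OF q x] sommerfeld_pos[OF q x] excess_pos[OF q x] rho_pos[OF q x]
    by (simp_all add: defs)
  have \<rho>: "\<rho> = D + k" using rho_eq[OF q x] by (simp add: defs)
  have \<alpha>: "norm (snd y) = \<alpha>" using norm_action[OF q x, of v] by (simp add: y_def \<alpha>_def)
  have L: "ang_sq y = 2 * \<alpha> * r * D - \<rho>\<^sup>2"
    using norm_cross_x_v[OF q x, of v] angle_cross_action[OF q x, of v]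
    by (simp add: ang_sq_cross y_def defs)
  have "kepler_lhs (1 + ang_sq y / k\<^sup>2) (ln (D / k)) = fst y \<bullet> snd y / k"
  proof -
    have "exp (ln (D / k)) = D / k" "exp (- ln (D / k)) = k / D"
      using pos by (simp_all add: exp_minus)
    moreover have "fst y \<bullet> snd y = \<rho> - \<alpha> * r + k * ln (D / k)"
      using angle_dot_action[OF q x, of v] x_dot_v[OF q x, of v] by (simp add: y_def defs)
    moreover have "l + (D / k - (1 + (2 * \<alpha> * r * D - \<rho>\<^sup>2) / k\<^sup>2) * (k / D)) / 2
        = (\<rho> - \<alpha> * r + k * l) / k" for l
      unfolding \<rho> using pos by (simp add: divide_simps) (simp add: algebra_simps power2_eq_square)
    ultimately show ?thesis by (simp add: kepler_lhs_def L)
  qed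
  then have w: "inv_w q y = ln (D / k)"
    unfolding inv_w_def \<alpha> Let_def k_def[symmetric]
    by (intro kepler_root_eqI add_pos_nonneg divide_nonneg_nonneg ang_sq_nonneg) auto
  then have D: "inv_excess q y = D"
    using pos by (simp add: inv_excess_def \<alpha> flip: k_def)
  then have \<rho>': "inv_rho q y = \<rho>" by (simp add: inv_rho_def \<alpha> \<rho> flip: k_def)
  then have r: "inv_r q y = r" unfolding inv_r_def D \<alpha> L using pos by simp
  have "inv_delay q y = delay q (x, v)"
    by (simp add: inv_delay_def delay_def \<alpha> w r \<rho>' flip: defs)
  then have "fst y - inv_delay q y *\<^sub>R snd y = (D / \<rho>) *\<^sub>R x"
    by (simp add: y_def angle_def flip: defs)
  then show x': "inv_x q y = x" using pos by (simp add: inv_x_def D \<rho>')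
  have "q / (2 * r * \<rho>) = (D / \<rho>) * (q / (2 * r * D))" using pos by simp
  moreover have "snd y = (\<rho> / D) *\<^sub>R v + (q / (2 * r * D)) *\<^sub>R x"
    by (simp add: y_def action_def flip: defs)
  ultimately show "inv_v q y = v"
    unfolding inv_v_def D \<rho>' r x' using pos by (simp add: scaleR_add_right)
qed

section \<open>Smoothness\<close>

lemma open_phase_xv: "open phase_xv"
proof -
  have "phase_xv = fst -` (- {0})" by (auto simp: phase_xv_def)
  then show ?thesis by (metis open_vimage_fst open_Compl closed_singleton)
qed

lemma open_phase_theta_a: "open phase_theta_a"
proof -
  have "phase_theta_a = snd -` (- {0})" by (auto simp: phase_theta_a_def)
  then show ?thesis by (metis open_vimage_snd open_Compl closed_singleton)
qed

context
  fixes q :: real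
  assumes q: "q > 0"
begin

lemma phase_xv_pos:
  assumes "p \<in> phase_xv"
  shows "fst p \<noteq> 0" "kepler_H q p > 0" "speed q p > 0" "sommerfeld q (speed q p) > 0"
    "excess q p > 0" "rho q p > 0"
  using assms kepler_H_pos[OF q, of "fst p" "snd p"] speed_pos[OF q, of "fst p" "snd p"]
    sommerfeld_pos[OF q, of "fst p" "snd p"] excess_pos[OF q, of "fst p" "snd p"]
    rho_pos[OF q, of "fst p" "snd p"]
  by (auto simp: phase_xv_def)

lemma smooth_on_speed: "smooth_on phase_xv (speed q)"
proof -
  have "kepler_H q p = snd p \<bullet> snd p + q / norm (fst p)" for p
    by (simp add: kepler_H_def case_prod_unfold dot_square_norm)
  then have "speed q = (\<lambda>p. sqrt (snd p \<bullet> snd p + q / norm (fst p)))"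
    and "p \<in> phase_xv \<Longrightarrow> 0 < snd p \<bullet> snd p + q / norm (fst p)" for p
    using phase_xv_pos(2)[of p] by (auto simp: speed_def fun_eq_iff)
  then show ?thesis
    by (simp add: smooth_on_intros open_phase_xv phase_xv_pos(1))
qed

lemma smooth_on_forward: "smooth_on phase_xv (\<lambda>p. (angle q p, action q p))"
proof -
  note intros = smooth_on_intros open_phase_xv smooth_on_speed
  have k: "smooth_on phase_xv (\<lambda>p. sommerfeld q (speed q p))"
    unfolding sommerfeld_def by (intro intros) (simp add: phase_xv_pos)
  have rho: "smooth_on phase_xv (rho q)"
    unfolding rho_def[abs_def] by (intro intros) (simp add: phase_xv_pos)
  have excess: "smooth_on phase_xv (excess q)"
    unfolding excess_def[abs_def] by (intro intros k rho)
  have action: "smooth_on phase_xv (action q)"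
    unfolding action_def[abs_def] by (intro intros rho excess) (simp_all add: phase_xv_pos)
  have "speed q p \<noteq> 0" if "p \<in> phase_xv" for p
    using phase_xv_pos(3)[OF that] by simp
  then have "smooth_on phase_xv (delay q)"
    unfolding delay_def[abs_def] by (intro intros rho excess k) (simp_all add: phase_xv_pos)
  then show ?thesis
    unfolding angle_def[abs_def] by (intro intros rho excess action) (simp_all add: phase_xv_pos)
qed

lemma phase_theta_a_pos:
  assumes "y \<in> phase_theta_a"
  shows "snd y \<noteq> 0" "sommerfeld q (norm (snd y)) > 0" "inv_excess q y > 0"
    "inv_rho q y > 0" "inv_r q y > 0"
proof -
  obtain \<theta> a where "y = (\<theta>, a)" "a \<noteq> 0" using assms by (auto simp: phase_theta_a_def)
  then show "snd y \<noteq> 0" "sommerfeld q (norm (snd y)) > 0" "inv_excess q y > 0"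
    "inv_rho q y > 0" "inv_r q y > 0"
    using inv_pos[OF q, of a] inv_r_pos[OF q, of a] by auto
qed

lemma smooth_on_inverse: "smooth_on phase_theta_a (\<lambda>y. (inv_x q y, inv_v q y))"
proof -
  note intros = smooth_on_intros open_phase_theta_a
  have a: "smooth_on phase_theta_a (\<lambda>y. norm (snd y))"
    by (intro intros) (simp add: phase_theta_a_pos)
  have k: "smooth_on phase_theta_a (\<lambda>y. sommerfeld q (norm (snd y)))"
    unfolding sommerfeld_def by (intro intros a) (simp_all add: phase_theta_a_pos)
  have L: "smooth_on phase_theta_a ang_sq"
    unfolding ang_sq_def[abs_def] power2_norm_eq_inner by (intro intros)
  have k0: "sommerfeld q (norm (snd y)) \<noteq> 0" if "y \<in> phase_theta_a" for y
    using phase_theta_a_pos(2)[OF that] by simp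
  have "smooth_on phase_theta_a (\<lambda>y. (1 + ang_sq y / (sommerfeld q (norm (snd y)))\<^sup>2,
      fst y \<bullet> snd y / sommerfeld q (norm (snd y))))"
    by (intro intros k L) (simp_all add: phase_theta_a_pos k0)
  moreover have "0 < 1 + ang_sq y / (sommerfeld q (norm (snd y)))\<^sup>2" for y
    by (intro add_pos_nonneg divide_nonneg_nonneg ang_sq_nonneg) auto
  moreover have "open ({0::real<..} \<times> (UNIV :: real set))" by (intro open_Times) auto
  ultimately have "smooth_on phase_theta_a (\<lambda>y. (\<lambda>(C, m). kepler_root C m)
      (1 + ang_sq y / (sommerfeld q (norm (snd y)))\<^sup>2, fst y \<bullet> snd y / sommerfeld q (norm (snd y))))"
    by (intro smooth_on_compose[OF open_phase_theta_a _ smooth_on_kepler_root]) auto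
  then have w: "smooth_on phase_theta_a (inv_w q)"
    by (simp add: inv_w_def[abs_def] Let_def)
  have D: "smooth_on phase_theta_a (inv_excess q)"
    unfolding inv_excess_def[abs_def] by (intro intros k w)
  have rho: "smooth_on phase_theta_a (inv_rho q)"
    unfolding inv_rho_def[abs_def] by (intro intros k D)
  have r: "smooth_on phase_theta_a (inv_r q)"
    unfolding inv_r_def[abs_def] by (intro intros a rho D L) (simp_all add: phase_theta_a_pos)
  have delay: "smooth_on phase_theta_a (inv_delay q)"
    unfolding inv_delay_def[abs_def] by (intro intros a k w r rho) (simp_all add: phase_theta_a_pos)
  have x: "smooth_on phase_theta_a (inv_x q)"
    unfolding inv_x_def[abs_def] by (intro intros rho D delay) (simp_all add: phase_theta_a_pos)
  have v: "smooth_on phase_theta_a (inv_v q)"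
    unfolding inv_v_def[abs_def] by (intro intros rho D r x) (simp_all add: phase_theta_a_pos)
  show ?thesis by (intro intros x v)
qed

lemma forward_inverse_phase:
  assumes "y \<in> phase_theta_a"
  shows "(inv_x q y, inv_v q y) \<in> phase_xv" "angle q (inv_x q y, inv_v q y) = fst y"
    "action q (inv_x q y, inv_v q y) = snd y"
  using assms forward_inverse[OF q, of "snd y" "fst y"]
  by (auto simp: phase_theta_a_def phase_xv_def)

lemma inverse_forward_phase:
  assumes "p \<in> phase_xv"
  shows "(angle q p, action q p) \<in> phase_theta_a" "inv_x q (angle q p, action q p) = fst p"
    "inv_v q (angle q p, action q p) = snd p"
proof -
  obtain x v where p: "p = (x, v)" "x \<noteq> 0" using assms by (auto simp: phase_xv_def)
  then show "inv_x q (angle q p, action q p) = fst p" "inv_v q (angle q p, action q p) = snd p"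
    using inverse_forward[OF q, of x v] by auto
  show "(angle q p, action q p) \<in> phase_theta_a"
    using norm_action[OF q p(2), of v] speed_pos[OF q p(2), of v] unfolding p
    by (simp add: phase_theta_a_def del: zero_less_norm_iff)
qed

lemma smooth_diffeomorphism_forward:
  "smooth_diffeomorphism phase_xv phase_theta_a
     (\<lambda>p. (angle q p, action q p)) (\<lambda>y. (inv_x q y, inv_v q y))"
  unfolding smooth_diffeomorphism_def
proof (intro conjI smooth_on_forward smooth_on_inverse homeomorphismI)
  show "continuous_on phase_xv (\<lambda>p. (angle q p, action q p))"
    "continuous_on phase_theta_a (\<lambda>y. (inv_x q y, inv_v q y))"
    using smooth_on_forward smooth_on_inverse by (auto intro: smooth_on_continuous_on)
qed (auto simp: forward_inverse_phase inverse_forward_phase)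

section \<open>The Kepler flow\<close>

lemma forward_has_derivative:
  assumes "p \<in> phase_xv"
  shows "(angle q has_derivative d_angle q p) (at p)" "(action q has_derivative d_action q p) (at p)"
  using assms angle_has_derivative[OF q, of "fst p" "snd p"] action_has_derivative[OF q, of "fst p" "snd p"]
  by (auto simp: phase_xv_def)

lemma forward_kepler_field:
  assumes "p \<in> phase_xv"
  shows "d_angle q p (kepler_field q p) = action q p" "d_action q p (kepler_field q p) = 0"
  using assms along_flow[OF q, of "fst p" "snd p"]
  by (auto simp: phase_xv_def)

text \<open>The inverse differential carries \<open>(A, 0)\<close> back to the Kepler field, since the forward
  differential carries the Kepler field to \<open>(A, 0)\<close>.\<close>

lemma inverse_kepler_field:
  assumes "p \<in> phase_xv"
  shows "frechet_derivative (\<lambda>y. (inv_x q y, inv_v q y)) (at (angle q p, action q p)) (action q p, 0)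
    = kepler_field q p"
proof -
  let ?G = "\<lambda>y. (inv_x q y, inv_v q y)"
  have "(?G has_derivative frechet_derivative ?G (at (angle q p, action q p))) (at (angle q p, action q p))"
    by (intro smooth_on_has_derivative[OF smooth_on_inverse] inverse_forward_phase assms)
  from has_derivative_compose[OF has_derivative_Pair[OF forward_has_derivative[OF assms]] this]
  have "((\<lambda>z. z) has_derivative (\<lambda>\<xi>. frechet_derivative ?G (at (angle q p, action q p))
      (d_angle q p \<xi>, d_action q p \<xi>))) (at p)"
    by (rule has_derivative_transform_within_open[OF _ open_phase_xv assms])
       (simp add: inverse_forward_phase)
  from has_derivative_unique[OF this has_derivative_ident] show ?thesis
    using forward_kepler_field[OF assms] by (metis (no_types, lifting))
qed

lemma kepler_solution_on_iff:
  "kepler_solution_on q I x v \<longleftrightarrow>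
     (\<forall>t\<in>I. ((\<lambda>t. (x t, v t)) has_vector_derivative kepler_field q (x t, v t)) (at t within I))"
proof -
  have "((\<lambda>t. (x t, v t)) has_vector_derivative (a, b)) (at t within I) \<longleftrightarrow>
      (x has_vector_derivative a) (at t within I) \<and> (v has_vector_derivative b) (at t within I)"
    for a b :: "real^3" and t
  proof
    assume *: "((\<lambda>t. (x t, v t)) has_vector_derivative (a, b)) (at t within I)"
    from bounded_linear.has_vector_derivative[OF bounded_linear_fst *]
      bounded_linear.has_vector_derivative[OF bounded_linear_snd *]
    show "(x has_vector_derivative a) (at t within I) \<and> (v has_vector_derivative b) (at t within I)"
      by simp
  next
    assume "(x has_vector_derivative a) (at t within I) \<and> (v has_vector_derivative b) (at t within I)"
    then show "((\<lambda>t. (x t, v t)) has_vector_derivative (a, b)) (at t within I)"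
      by (auto intro: has_vector_derivative_Pair)
  qed
  then show ?thesis by (simp add: kepler_solution_on_def kepler_field_def)
qed

text \<open>For the converse, a curve with affine image is the image of a straight line under the smooth
  inverse, hence is differentiable, and the chain rule computes its derivative.\<close>

lemma linearizes_flow:
  assumes I: "is_interval I" "0 \<in> I" and dom: "\<And>t. t \<in> I \<Longrightarrow> (x t, v t) \<in> phase_xv"
  shows "kepler_solution_on q I x v \<longleftrightarrow>
    (\<forall>t\<in>I. angle q (x t, v t) = angle q (x 0, v 0) + t *\<^sub>R action q (x 0, v 0) \<and>
           action q (x t, v t) = action q (x 0, v 0))" (is "_ \<longleftrightarrow> ?R")
proof
  assume "kepler_solution_on q I x v"
  then have p': "((\<lambda>t. (x t, v t)) has_vector_derivative kepler_field q (x t, v t)) (at t within I)"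
    if "t \<in> I" for t
    using that by (simp add: kepler_solution_on_iff)
  have chain: "((\<lambda>t. F (x t, v t)) has_vector_derivative F' (kepler_field q (x t, v t))) (at t within I)"
    if "t \<in> I" "(F has_derivative F') (at (x t, v t))" for F :: "phase \<Rightarrow> real^3" and F' t
    using vector_derivative_diff_chain_within[OF p'[OF that(1)] has_derivative_at_withinI[OF that(2)]]
    by (simp add: o_def)
  have convex: "convex I" using I(1) by (rule is_interval_convex)
  have "((\<lambda>t. action q (x t, v t)) has_derivative (\<lambda>h. 0)) (at t within I)" if "t \<in> I" for t
    using chain[OF that forward_has_derivative(2)[OF dom[OF that]]] forward_kepler_field(2)[OF dom[OF that]]
    by (simp add: has_vector_derivative_def)
  from has_derivative_zero_constant[OF convex this]
  obtain A where "\<And>t. t \<in> I \<Longrightarrow> action q (x t, v t) = A" by auto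
  then have A: "action q (x t, v t) = action q (x 0, v 0)" if "t \<in> I" for t
    using that I(2) by simp
  have "((\<lambda>t. angle q (x t, v t) - t *\<^sub>R action q (x 0, v 0)) has_derivative (\<lambda>h. 0)) (at t within I)"
    if "t \<in> I" for t
  proof -
    have "((\<lambda>t. angle q (x t, v t)) has_vector_derivative action q (x 0, v 0)) (at t within I)"
      using chain[OF that forward_has_derivative(1)[OF dom[OF that]]] A[OF that]
      by (simp add: forward_kepler_field(1)[OF dom[OF that]])
    moreover have "((\<lambda>t. t *\<^sub>R action q (x 0, v 0)) has_derivative (\<lambda>h. h *\<^sub>R action q (x 0, v 0)))
        (at t within I)"
      by (rule has_derivative_scaleR_left[OF has_derivative_ident])
    ultimately show ?thesis
      unfolding has_vector_derivative_def by (auto dest: has_derivative_diff)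
  qed
  from has_derivative_zero_constant[OF convex this]
  obtain T where T: "\<And>t. t \<in> I \<Longrightarrow> angle q (x t, v t) - t *\<^sub>R action q (x 0, v 0) = T" by auto
  then have "angle q (x t, v t) - t *\<^sub>R action q (x 0, v 0) = angle q (x 0, v 0)" if "t \<in> I" for t
    using T[OF that] T[OF I(2)] by simp
  then show ?R using A by (simp add: diff_eq_eq add.commute)
next
  assume R: ?R
  let ?G = "\<lambda>y. (inv_x q y, inv_v q y)" and ?A = "action q (x 0, v 0)"
  let ?y = "\<lambda>t. (angle q (x 0, v 0) + t *\<^sub>R ?A, ?A)"
  have y: "?y t = (angle q (x t, v t), action q (x t, v t))" if "t \<in> I" for t
    using R that by simp
  have "((\<lambda>t. (x t, v t)) has_vector_derivative kepler_field q (x t, v t)) (at t within I)"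
    if "t \<in> I" for t
  proof -
    have "?y t \<in> phase_theta_a"
      unfolding y[OF that] by (rule inverse_forward_phase(1)[OF dom[OF that]])
    then have "(?G has_derivative frechet_derivative ?G (at (?y t))) (at (?y t) within ?y ` I)"
      by (rule has_derivative_at_withinI[OF smooth_on_has_derivative[OF smooth_on_inverse]])
    moreover have "(?y has_vector_derivative (?A, 0)) (at t within I)"
      unfolding has_vector_derivative_def by (auto intro!: derivative_eq_intros)
    ultimately have "((?G \<circ> ?y) has_vector_derivative frechet_derivative ?G (at (?y t)) (?A, 0))
        (at t within I)"
      by (rule vector_derivative_diff_chain_within[rotated])
    moreover have "frechet_derivative ?G (at (?y t)) (?A, 0) = kepler_field q (x t, v t)"
      using inverse_kepler_field[OF dom[OF that]] R that by simp
    ultimately have D: "((?G \<circ> ?y) has_vector_derivative kepler_field q (x t, v t)) (at t within I)"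
      by (simp only:)
    have G: "(?G \<circ> ?y) s = (x s, v s)" if "s \<in> I" for s
      unfolding o_def y[OF that] by (simp add: inverse_forward_phase[OF dom[OF that]])
    show ?thesis
      by (rule has_vector_derivative_transform[OF that _ D]) (rule G[symmetric])
  qed
  then show "kepler_solution_on q I x v" by (simp add: kepler_solution_on_iff)
qed

lemma wedge_d_eq_inner:
  fixes F G :: "phase \<Rightarrow> real^3"
  assumes "(F has_derivative F') (at p)" "(G has_derivative G') (at p)"
  shows "wedge_d F G p = (\<lambda>\<xi> \<eta>. F' \<xi> \<bullet> G' \<eta> - F' \<eta> \<bullet> G' \<xi>)"
proof -
  have "frechet_derivative (\<lambda>z. H z $ j) (at p) = (\<lambda>\<xi>. H' \<xi> $ j)"
    if "(H has_derivative H') (at p)" for H :: "phase \<Rightarrow> real^3" and H' j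
    using bounded_linear.has_derivative[OF bounded_linear_vec_nth that]
    by (rule frechet_derivative_at[symmetric])
  then show ?thesis
    using assms by (simp add: wedge_d_def wedge_def inner_vec_def sum_subtractf fun_eq_iff)
qed

lemma canonical:
  assumes "p \<in> phase_xv"
  shows "wedge_d fst snd p = wedge_d (angle q) (action q) p"
proof -
  obtain x v where p: "p = (x, v)" "x \<noteq> 0" using assms by (auto simp: phase_xv_def)
  have "wedge_d (angle q) (action q) p =
      (\<lambda>\<xi> \<eta>. d_angle q p \<xi> \<bullet> d_action q p \<eta> - d_angle q p \<eta> \<bullet> d_action q p \<xi>)"
    unfolding p using angle_has_derivative[OF q p(2)] action_has_derivative[OF q p(2)]
    by (rule wedge_d_eq_inner)
  moreover have "wedge_d fst snd p = (\<lambda>\<xi> \<eta>. fst \<xi> \<bullet> snd \<eta> - fst \<eta> \<bullet> snd \<xi>)"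
    by (rule wedge_d_eq_inner) (auto intro!: derivative_eq_intros)
  ultimately show ?thesis using angle_action_canonical[OF q p(2), of v] p by simp
qed

end

section \<open>Asymptotics\<close>

lemma filterlim_kepler_root:
  assumes "C > 0"
  shows "filterlim (kepler_root C) at_top at_top"
  unfolding filterlim_at_top
proof
  fix Z
  have ge: "Z \<le> kepler_root C m" if "kepler_lhs C Z \<le> m" for m
  proof (rule ccontr)
    assume "\<not> Z \<le> kepler_root C m"
    then have "kepler_lhs C (kepler_root C m) < kepler_lhs C Z"
      by (intro kepler_lhs_strict_mono assms) simp
    then show False using that by (simp add: kepler_lhs_root[OF assms])
  qed
  show "\<forall>\<^sub>F m in at_top. Z \<le> kepler_root C m"
    using eventually_ge_at_top[of "kepler_lhs C Z"] by (rule eventually_mono) (rule ge)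
qed

text \<open>In terms of \<open>w\<close> the quotient is \<open>w / kepler_lhs C w\<close>, where the denominator grows like
  \<open>e\<^sup>w / 2\<close>.\<close>

lemma kepler_root_sublinear:
  assumes "C > 0"
  shows "((\<lambda>m. kepler_root C m / m) \<longlongrightarrow> 0) at_top"
proof -
  define E where "E w = exp (- w)" for w :: real
  have E: "(E \<longlongrightarrow> 0) at_top"
    unfolding E_def by (rule filterlim_compose[OF exp_at_bot filterlim_uminus_at_bot_at_top])
  have wE: "((\<lambda>w. w * E w) \<longlongrightarrow> 0) at_top"
    using tendsto_power_div_exp_0[of 1] by (simp add: E_def exp_minus divide_inverse)
  have "((\<lambda>w. w * E w + (1 - C * (E w * E w)) / 2) \<longlongrightarrow> 0 + (1 - C * (0 * 0)) / 2) at_top"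
    by (intro tendsto_add tendsto_divide tendsto_diff tendsto_mult tendsto_const E wE) simp
  moreover have "w * E w + (1 - C * (E w * E w)) / 2 = kepler_lhs C w * E w" for w
  proof -
    have "exp w * E w = 1" by (simp add: E_def flip: exp_add)
    then have "w * E w + (1 - C * (E w * E w)) / 2 = w * E w + (exp w * E w - C * (E w * E w)) / 2"
      by simp
    also have "\<dots> = kepler_lhs C w * E w" by (simp add: kepler_lhs_def E_def algebra_simps)
    finally show ?thesis .
  qed
  ultimately have "((\<lambda>w. kepler_lhs C w * E w) \<longlongrightarrow> 1 / 2) at_top" by simp
  from tendsto_divide[OF wE this] have "((\<lambda>w. w / kepler_lhs C w) \<longlongrightarrow> 0) at_top"
    by (simp add: E_def)
  from filterlim_compose[OF this filterlim_kepler_root[OF assms]] show ?thesis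
    by (simp add: kepler_lhs_root[OF assms])
qed

text \<open>Everything is expressed through \<open>E = e\<^sup>-\<^sup>w\<close>, which tends to \<open>0\<close>: the position is
  \<open>(1 + E) (\<theta> + t a - \<delta> a)\<close> with \<open>\<delta> = o(t)\<close>, and the velocity differs from \<open>a\<close> by at most
  \<open>2\<alpha> E\<close>.\<close>

lemma asymptotic_action:
  fixes \<theta> a :: "real^3"
  assumes q: "q > 0" and a: "a \<noteq> 0"
  shows "(\<lambda>t::real. norm (inv_x q (\<theta> + t *\<^sub>R a, a) - t *\<^sub>R a)) \<in> o[at_top](\<lambda>t. t)"
    and "(\<lambda>t::real. norm (inv_v q (\<theta> + t *\<^sub>R a, a) - a)) \<in> o[at_top](\<lambda>_. 1)"
proof -
  define \<alpha> where "\<alpha> = norm a"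
  define k where "k = sommerfeld q \<alpha>"
  define L where "L = ang_sq (\<theta>, a)"
  define C where "C = 1 + L / k\<^sup>2"
  define y where "y t = (\<theta> + t *\<^sub>R a, a)" for t
  define w where "w t = inv_w q (y t)" for t
  have \<alpha>: "\<alpha> > 0" using a by (simp add: \<alpha>_def)
  have k: "k > 0" using q \<alpha> by (simp add: k_def sommerfeld_def)
  have C: "C > 0" using ang_sq_nonneg[of "(\<theta>, a)"]
    unfolding C_def L_def by (intro add_pos_nonneg divide_nonneg_nonneg) auto
  have L: "ang_sq (y t) = L" for t
    by (simp add: L_def y_def ang_sq_cross cross_add_left cross_mult_left)
  have w: "w t = kepler_root C (\<theta> \<bullet> a / k + t * (\<alpha>\<^sup>2 / k))" for t
    unfolding w_def inv_w_def Let_def L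
    by (simp add: y_def C_def k_def \<alpha>_def inner_simps dot_square_norm add_divide_distrib)
  define m where "m t = \<theta> \<bullet> a / k + t * (\<alpha>\<^sup>2 / k)" for t
  have m_top: "filterlim m at_top at_top"
    unfolding m_def using \<alpha> k
    by (intro filterlim_tendsto_add_at_top[OF tendsto_const] filterlim_at_top_mult_tendsto_pos[OF tendsto_const]
        filterlim_ident) auto
  have w_top: "filterlim w at_top at_top"
    unfolding w using filterlim_compose[OF filterlim_kepler_root[OF C] m_top] by (simp add: m_def)
  have inv_t: "((\<lambda>t::real. 1 / t) \<longlongrightarrow> 0) at_top"
    using tendsto_inverse_0_at_top[OF filterlim_ident] by (simp add: inverse_eq_divide)
  have w_t: "((\<lambda>t. w t / t) \<longlongrightarrow> 0) at_top"
  proof -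
    have "((\<lambda>t. (kepler_root C (m t) / m t) * (\<theta> \<bullet> a / k * (1 / t) + \<alpha>\<^sup>2 / k)) \<longlongrightarrow>
        0 * (\<theta> \<bullet> a / k * 0 + \<alpha>\<^sup>2 / k)) at_top"
      by (intro tendsto_intros inv_t filterlim_compose[OF kepler_root_sublinear[OF C] m_top])
    moreover have "\<forall>\<^sub>F t in at_top. (kepler_root C (m t) / m t) * (\<theta> \<bullet> a / k * (1 / t) + \<alpha>\<^sup>2 / k) = w t / t"
      using eventually_gt_at_top[of 0] m_top[unfolded filterlim_at_top_dense, rule_format, of 0]
    proof eventually_elim
      case (elim t)
      then have "\<theta> \<bullet> a / k * (1 / t) + \<alpha>\<^sup>2 / k = m t / t" by (simp add: m_def field_simps)
      with elim show ?case by (simp add: w m_def)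
    qed
    ultimately show ?thesis using tendsto_cong by force
  qed
  define E where "E t = exp (- w t)" for t
  have E: "(E \<longlongrightarrow> 0) at_top"
    unfolding E_def
    by (rule filterlim_compose[OF exp_at_bot filterlim_compose[OF filterlim_uminus_at_bot_at_top w_top]])
  have E_pos: "E t > 0" for t by (simp add: E_def)
  have pos: "inv_excess q (y t) > 0" "inv_rho q (y t) > 0" "inv_r q (y t) > 0" for t
    using inv_pos[OF q a] inv_r_pos[OF q a] by (simp_all add: y_def)
  have k_y: "sommerfeld q (norm (snd (y t))) = k" for t by (simp add: k_def \<alpha>_def y_def)
  have D: "inv_excess q (y t) = k / E t" for t
    unfolding inv_excess_def k_y by (simp add: w_def E_def exp_minus divide_inverse)
  have rho: "inv_rho q (y t) = k * (1 + E t) / E t" for t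
    using E_pos[of t] unfolding inv_rho_def D k_y by (simp add: add_divide_distrib distrib_left)
  \<comment> \<open>The ratio \<open>\<alpha>|x| / \<rho>\<close>, which stays bounded because it tends to \<open>1/2\<close>.\<close>
  define h where "h t = L * E t * E t / (2 * k\<^sup>2 * (1 + E t)) + (1 + E t) / 2" for t
  have delay: "inv_delay q (y t) = k / \<alpha>\<^sup>2 * (w t - h t)" for t
  proof -
    have "\<alpha> * inv_r q (y t) / inv_rho q (y t) = h t"
      using E_pos[of t] \<alpha> k
      unfolding inv_r_def D rho L h_def
      by (simp add: y_def add_pos_pos[THEN less_imp_neq, symmetric] divide_simps flip: \<alpha>_def)
         (simp add: algebra_simps power2_eq_square)
    then show ?thesis by (simp add: inv_delay_def y_def w_def flip: \<alpha>_def k_def)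
  qed
  have ratio: "inv_rho q (y t) / inv_excess q (y t) = 1 + E t" for t
    using E_pos[of t] k unfolding rho D by simp
  have "(h \<longlongrightarrow> L * 0 * 0 / (2 * k\<^sup>2 * (1 + 0)) + (1 + 0) / 2) at_top"
    unfolding h_def using k by (intro tendsto_intros E) auto
  then have "((\<lambda>t. k / \<alpha>\<^sup>2 * (w t / t - h t * (1 / t))) \<longlongrightarrow>
      k / \<alpha>\<^sup>2 * (0 - (L * 0 * 0 / (2 * k\<^sup>2 * (1 + 0)) + (1 + 0) / 2) * 0)) at_top"
    by (intro tendsto_intros w_t inv_t)
  then have delay_t: "((\<lambda>t. inv_delay q (y t) / t) \<longlongrightarrow> 0) at_top"
    unfolding delay by (simp add: diff_divide_distrib right_diff_distrib)
  have "((\<lambda>t. (1 + E t) *\<^sub>R ((1 / t) *\<^sub>R \<theta> + a - (inv_delay q (y t) / t) *\<^sub>R a) - a) \<longlongrightarrow>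
      (1 + 0) *\<^sub>R (0 *\<^sub>R \<theta> + a - 0 *\<^sub>R a) - a) at_top"
    by (intro tendsto_intros E inv_t delay_t)
  then have "((\<lambda>t. norm ((1 + E t) *\<^sub>R ((1 / t) *\<^sub>R \<theta> + a - (inv_delay q (y t) / t) *\<^sub>R a) - a)) \<longlongrightarrow> 0) at_top"
    by (intro tendsto_norm_zero) simp
  moreover have "\<forall>\<^sub>F t in at_top. norm ((1 + E t) *\<^sub>R ((1 / t) *\<^sub>R \<theta> + a - (inv_delay q (y t) / t) *\<^sub>R a) - a)
      = norm (inv_x q (y t) - t *\<^sub>R a) / t"
    using eventually_gt_at_top[of 0]
  proof eventually_elim
    case (elim t)
    have "(1 + E t) *\<^sub>R ((1 / t) *\<^sub>R \<theta> + a - (inv_delay q (y t) / t) *\<^sub>R a) - a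
        = (1 / t) *\<^sub>R (inv_x q (y t) - t *\<^sub>R a)"
      unfolding inv_x_def ratio using elim by (simp add: y_def algebra_simps add_divide_distrib)
    then show ?case using elim by simp
  qed
  ultimately have "((\<lambda>t. norm (inv_x q (y t) - t *\<^sub>R a) / t) \<longlongrightarrow> 0) at_top"
    using tendsto_cong by force
  then show "(\<lambda>t. norm (inv_x q (\<theta> + t *\<^sub>R a, a) - t *\<^sub>R a)) \<in> o[at_top](\<lambda>t. t)"
    unfolding y_def by (intro smalloI_tendsto eventually_mono[OF eventually_gt_at_top[of 0]]) auto
  have bound: "norm (inv_v q (y t) - a) \<le> 2 * \<alpha> * E t" for t
  proof -
    have "inv_excess q (y t) / inv_rho q (y t) - 1 = - E t / (1 + E t)"
    proof -
      have "inv_excess q (y t) / inv_rho q (y t) = 1 / (1 + E t)"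
        using E_pos[of t] k unfolding rho D by simp
      then show ?thesis using E_pos[of t] by (simp add: field_simps)
    qed
    moreover have "inv_v q (y t) - a = (inv_excess q (y t) / inv_rho q (y t) - 1) *\<^sub>R a
        - (q / (2 * inv_r q (y t) * inv_rho q (y t))) *\<^sub>R inv_x q (y t)"
      unfolding inv_v_def by (simp add: y_def scaleR_diff_left)
    ultimately have "inv_v q (y t) - a = (- E t / (1 + E t)) *\<^sub>R a
        - (q / (2 * inv_r q (y t) * inv_rho q (y t))) *\<^sub>R inv_x q (y t)"
      by (simp only:)
    then have "norm (inv_v q (y t) - a) \<le> norm ((- E t / (1 + E t)) *\<^sub>R a)
        + norm ((q / (2 * inv_r q (y t) * inv_rho q (y t))) *\<^sub>R inv_x q (y t))"
      using norm_triangle_ineq4 by metis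
    also have "norm (inv_x q (y t)) = inv_r q (y t)" unfolding y_def by (rule norm_inv_x[OF q a])
    then have "norm ((q / (2 * inv_r q (y t) * inv_rho q (y t))) *\<^sub>R inv_x q (y t)) = q / (2 * inv_rho q (y t))"
      using pos[of t] q by (simp add: abs_mult)
    also have "q / (2 * inv_rho q (y t)) = \<alpha> * E t / (1 + E t)"
    proof -
      have "q = 2 * k * \<alpha>" using inv_q_eq[OF q a] by (simp only: k_def \<alpha>_def)
      then have "q / (2 * inv_rho q (y t)) = 2 * k * \<alpha> / (2 * (k * (1 + E t) / E t))"
        unfolding rho by (simp only:)
      then show ?thesis using k by simp
    qed
    also have "norm ((- E t / (1 + E t)) *\<^sub>R a) = \<alpha> * E t / (1 + E t)"
      using E_pos[of t] by (simp add: \<alpha>_def)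
    also have "\<alpha> * E t / (1 + E t) + \<alpha> * E t / (1 + E t) \<le> \<alpha> * E t + \<alpha> * E t"
      using E_pos[of t] \<alpha> by (intro add_mono) (simp_all add: divide_le_eq)
    finally show ?thesis by simp
  qed
  have "((\<lambda>t. norm (inv_v q (y t) - a)) \<longlongrightarrow> 0) at_top"
  proof (rule tendsto_sandwich[where f = "\<lambda>_. 0" and h = "\<lambda>t. 2 * \<alpha> * E t"])
    show "((\<lambda>t. 2 * \<alpha> * E t) \<longlongrightarrow> 0) at_top" using tendsto_mult_left[OF E, of "2 * \<alpha>"] by simp
  qed (use bound in auto)
  then show "(\<lambda>t. norm (inv_v q (\<theta> + t *\<^sub>R a, a) - a)) \<in> o[at_top](\<lambda>_. 1)"
    unfolding y_def by (intro smalloI_tendsto) auto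
qed

theorem proposition1p4:
  fixes q :: real
  assumes "q > 0"
  shows "\<exists>(\<Theta> :: phase \<Rightarrow> real^3) (\<A> :: phase \<Rightarrow> real^3) (X :: phase \<Rightarrow> real^3) (V :: phase \<Rightarrow> real^3).
    smooth_diffeomorphism phase_xv phase_theta_a (\<lambda>p. (\<Theta> p, \<A> p)) (\<lambda>p. (X p, V p)) \<and>
    (\<forall>p\<in>phase_xv. wedge_d fst snd p = wedge_d \<Theta> \<A> p) \<and>
    (\<forall>(x, v)\<in>phase_xv. kepler_H q (x, v) = (norm (\<A> (x, v)))\<^sup>2 \<and>
                       cross3 x v = cross3 (\<Theta> (x, v)) (\<A> (x, v))) \<and>
    (\<forall>(I :: real set) (x :: real \<Rightarrow> real^3) (v :: real \<Rightarrow> real^3).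
       is_interval I \<longrightarrow> 0 \<in> I \<longrightarrow> (\<forall>t\<in>I. (x t, v t) \<in> phase_xv) \<longrightarrow>
       (kepler_solution_on q I x v \<longleftrightarrow>
        (\<forall>t\<in>I. \<Theta> (x t, v t) = \<Theta> (x 0, v 0) + t *\<^sub>R \<A> (x 0, v 0) \<and>
               \<A> (x t, v t) = \<A> (x 0, v 0)))) \<and>
    (\<forall>(\<theta>, a)\<in>phase_theta_a.
       (\<lambda>t::real. norm (X (\<theta> + t *\<^sub>R a, a) - t *\<^sub>R a)) \<in> o[at_top](\<lambda>t. t) \<and>
       (\<lambda>t::real. norm (V (\<theta> + t *\<^sub>R a, a) - a)) \<in> o[at_top](\<lambda>_. 1))"
proof (intro exI conjI ballI allI impI)
  show "smooth_diffeomorphism phase_xv phase_theta_a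
     (\<lambda>p. (angle q p, action q p)) (\<lambda>y. (inv_x q y, inv_v q y))"
    using assms by (rule smooth_diffeomorphism_forward)
  show "wedge_d fst snd p = wedge_d (angle q) (action q) p" if "p \<in> phase_xv" for p
    using assms that by (rule canonical)
  show "case p of (x, v) \<Rightarrow> kepler_H q (x, v) = (norm (action q (x, v)))\<^sup>2 \<and>
      cross3 x v = cross3 (angle q (x, v)) (action q (x, v))" if "p \<in> phase_xv" for p
    using that norm_action[OF assms] angle_cross_action[OF assms] kepler_H_pos[OF assms]
    by (auto simp: phase_xv_def speed_def less_imp_le)
  show "kepler_solution_on q I x v \<longleftrightarrow>
        (\<forall>t\<in>I. angle q (x t, v t) = angle q (x 0, v 0) + t *\<^sub>R action q (x 0, v 0) \<and>
               action q (x t, v t) = action q (x 0, v 0))"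
    if "is_interval I" "0 \<in> I" "\<forall>t\<in>I. (x t, v t) \<in> phase_xv" for I x v
    using linearizes_flow[OF assms that(1,2)] that(3) by blast
  show "case y of (\<theta>, a) \<Rightarrow>
       (\<lambda>t::real. norm (inv_x q (\<theta> + t *\<^sub>R a, a) - t *\<^sub>R a)) \<in> o[at_top](\<lambda>t. t) \<and>
       (\<lambda>t::real. norm (inv_v q (\<theta> + t *\<^sub>R a, a) - a)) \<in> o[at_top](\<lambda>_. 1)"
    if "y \<in> phase_theta_a" for y
    using that asymptotic_action[OF assms] by (auto simp: phase_theta_a_def)
qed

end
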